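(* In the setting described in the context, let $p\in\{1,\dots,d-1\}$ and define $J_p\in\{1,\dots,d_\infty\}$ by the condition $N_{J_p-1}<p\le N_{J_p}$. Assume that there exists $\varepsilon>0$ such that for all $s\in[1-\varepsilon,1+\varepsilon]$ $$\big\|\mathbb{E}_{s t_{n,k}}(\Theta\Theta^\top)-\Sigma_{n,k}\big\|_{op}=o(k^{-1/2})\qquad(n\to\infty).$$ Then for all maximizers $\hat V_{n,k}$ of $V\mapsto\hat M_{n,k}(\mathbf{\Pi}_V)$ in $\mathcal{V}_p$ one has \begin{align*} \sup_{V\in\mathcal{V}_p}M_{n,k}(\mathbf{\Pi}_V)-M_{n,k}(\mathbf{\Pi}_{\hat V_{n,k}}) &=O_P\bigg(\min_{1\le i\le p<j\le d+1}\Big(k^{-1}\Big(\frac1{\lambda_{i-1}^{(n)}-\lambda_{p+1}^{(n)}}+\frac1{\lambda_p^{(n)}-\lambda_j^{(n)}}\Big)+\lambda_i^{(n)}-\lambda_{j-1}^{(n)}\Big)\bigg)\\ &=O_P\Big(k^{-1}+\min\big(k^{-1/2},\lambda_{N_{J_p-1}+1}^{(n)}-\lambda_{N_{J_p}}^{(n)}\big)\Big), \end{align*} with the convention $\lambda_0^{(n)}:=\infty$ and $\lambda_{d+1}^{(n)}:=-\infty$.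
   Context: Let $\|\cdot\|$ be the Euclidean norm on $\mathbb{R}^d$. The random vector $X\in\mathbb{R}^d$ is regularly varying: there is a non-degenerate measure $\mu$ on $\mathbb{R}^d\setminus\{0\}$ such that for all Borel $\mu$-continuity sets $B$ bounded away from $0$, $\lim_{t\to\infty}\mathbb{P}\{X/t\in B\}/\mathbb{P}\{\|X\|>t\}=\mu(B)<\infty$. (Then $\mu$ is homogeneous of order $-\alpha$ for some $\alpha>0$ and $\mu\{\|x\|>1\}=1$.) Let $X_1,X_2,\dots$ be i.i.d. copies of $X$. Scaling: $\omega:\mathbb{R}^d\to(0,\infty)$ is a measurable function such that $x\mapsto\omega(x)x$ is bounded (the standard choice being $\omega(x)=1/\|x\|$ for $x\neq0$). Put $R=\|X\|$, $\Theta=\omega(X)X$, $R_i=\|X_i\|$, $\Theta_i=\omega(X_i)X_i$. $\mathbb{E}_t$ denotes conditional expectation given $R>t$. $\mathbb{E}_\infty$ denotes expectation in the limit model, i.e. when $X$ is distributed according to the probability measure $\mu$ restricted to $\{\|x\|>1\}$. The conditional distribution of $\Theta$ given $R>t$ converges weakly, as $t\to\infty$, to the distribution of $\Theta$ in the limit model (automatic for $\omega(x)=1/\|x\|$). Here $k=k_n\in\{1,\dots,n-1\}$ is an intermediate sequence: $k\to\infty$ and $k/n\to0$ as $n\to\infty$. $t_{n,k}$ is the $(1-k/n)$-quantile of $R$, and $\hat t_{n,k}$ is the $(k+1)$-th largest order statistic of $R_1,\dots,R_n$. The distribution function of $R$ is continuous, so that almost surely exactly $k$ of the $R_i$ exceed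 $\hat t_{n,k}$. Define $\Sigma_{n,k}=\mathbb{E}_{t_{n,k}}(\Theta\Theta^\top)$ and $\Sigma_\infty=\mathbb{E}_\infty(\Theta\Theta^\top)$. $\|A\|_{op}=\sup_{\|x\|=1}\|Ax\|$ is the operator norm; $\mathbf{\Pi}_V$ is the orthogonal projection matrix onto the subspace $V$; $\mathcal{V}_p$ is the set of $p$-dimensional linear subspaces of $\mathbb{R}^d$. Risks: for a (possibly random) $V\in\mathcal{V}_p$, $M_{n,k}(\mathbf{\Pi}_V)=\mathrm{tr}(\Sigma_{n,k}\mathbf{\Pi}_V)$, which for non-random $V$ equals $\mathbb{E}_{t_{n,k}}(\Theta^\top\mathbf{\Pi}_V\Theta)$, and $\hat M_{n,k}(\mathbf{\Pi}_V)=\frac1k\sum_{i=1}^n\Theta_i^\top\mathbf{\Pi}_V\Theta_i\mathbf{1}_{\{R_i>\hat t_{n,k}\}}$. Eigenvalues: $\lambda_1^{(n)}\ge\dots\ge\lambda_d^{(n)}$ and $\lambda_1^{(\infty)}\ge\dots\ge\lambda_d^{(\infty)}$ are the eigenvalues of $\Sigma_{n,k}$ and $\Sigma_\infty$. Let $\mu_1>\dots>\mu_{d_\infty}$ be the distinct eigenvalues of $\Sigma_\infty$ and $0=N_0<N_1<\dots<N_{d_\infty}=d$ be such that $\lambda_m^{(\infty)}=\mu_j$ for $N_{j-1}<m\le N_j$. Conventions: $1/\infty=0$ and $1/0=\infty$. *)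

theory Defs
  imports
    "HOL-Probability.Probability"
    "HOL-Computational_Algebra.Polynomial"
    "HOL-Library.Landau_Symbols"
    "HOL-Library.Extended_Real"
begin

section \<open>Linear algebra\<close>

definition outer_square :: "real^'d \<Rightarrow> real^'d^'d" where
  "outer_square v = (\<chi> i j. v $ i * v $ j)"

definition subspaces_of_dim :: "nat \<Rightarrow> (real^'d) set set" where
  "subspaces_of_dim p = {V. subspace V \<and> dim V = p}"

definition proj_matrix :: "(real^'d) set \<Rightarrow> real^'d^'d" where
  "proj_matrix V = (THE P. \<forall>x. P *v x \<in> V \<and> (\<forall>v\<in>V. orthogonal (x - P *v x) v))"

definition charpoly :: "real^'d^'d \<Rightarrow> real poly" where
  "charpoly A = det (mat [:0, 1:] - map_matrix (\<lambda>c. [:c:]) A)"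

text \<open>The \<open>m\<close>-th largest eigenvalue, counted with multiplicity, for \<open>m\<close> from \<open>1\<close> to \<open>d\<close>; the values at
  \<open>0\<close> and \<open>d + 1\<close> are the conventions \<open>\<lambda>\<^sub>0 = \<infinity>\<close> and \<open>\<lambda>\<^bsub>d+1\<^esub> = -\<infinity>\<close>. It is only meant for symmetric
  matrices, for which all \<open>d\<close> roots of the characteristic polynomial are real.\<close>

definition eigval :: "real^'d^'d \<Rightarrow> nat \<Rightarrow> ereal" where
  "eigval A m =
    (if m = 0 then \<infinity>
     else if m \<le> CARD('d) then ereal (rev (sorted_list_of_multiset (proots (charpoly A))) ! (m - 1))
     else - \<infinity>)"

section \<open>Probability\<close>

definition weakly_converges ::
    "('i \<Rightarrow> 'b::topological_space measure) \<Rightarrow> 'b measure \<Rightarrow> 'i filter \<Rightarrow> bool" where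
  "weakly_converges N L F \<longleftrightarrow>
    (\<forall>f::'b \<Rightarrow> real. continuous_on UNIV f \<and> bounded (range f) \<longrightarrow>
      ((\<lambda>i. \<integral>x. f x \<partial>N i) \<longlongrightarrow> (\<integral>x. f x \<partial>L)) F)"

definition quantile :: "'w measure \<Rightarrow> ('w \<Rightarrow> real) \<Rightarrow> real \<Rightarrow> real" where
  "quantile M R q = Inf {x. q \<le> cdf (distr M borel R) x}"

text \<open>\<open>Z n = O\<^sub>P(a n)\<close>. The rate is extended real because it is assembled from eigenvalues with infinite
  conventions. \<open>Z n\<close> need not be measurable (it may involve an arbitrary choice of a maximizer), so the
  outer measure is used; it agrees with \<open>emeasure M\<close> on measurable events.\<close>

definition bigO_prob :: "'w measure \<Rightarrow> (nat \<Rightarrow> 'w \<Rightarrow> real) \<Rightarrow> (nat \<Rightarrow> ereal) \<Rightarrow> bool" where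
  "bigO_prob M Z a \<longleftrightarrow>
    (\<forall>\<epsilon>>0. \<exists>C>0. \<forall>\<^sub>F n in sequentially.
      outer_measure_of M {w \<in> space M. ereal C * a n < ereal \<bar>Z n w\<bar>} \<le> ennreal \<epsilon>)"

section \<open>Regular variation and exceedances\<close>

definition exceedance :: "'w measure \<Rightarrow> ('w \<Rightarrow> real^'d) \<Rightarrow> real \<Rightarrow> 'w set" where
  "exceedance M X t = {w \<in> space M. t < norm (X w)}"

text \<open>The limit measure lives on the punctured space and is finite on all Borel sets bounded away from
  the origin: without the latter, a measure with too few continuity sets (such as the counting measure)
  would satisfy the limit relation vacuously. Positivity of the exceedance probabilities makes
  the quotients meaningful.\<close>

definition regularly_varying :: "'w measure \<Rightarrow> ('w \<Rightarrow> real^'d) \<Rightarrow> (real^'d) measure \<Rightarrow> bool" where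
  "regularly_varying M X \<mu> \<longleftrightarrow>
    sets \<mu> = sets (restrict_space borel (- {0})) \<and>
    emeasure \<mu> (space \<mu>) \<noteq> 0 \<and>
    (\<forall>B\<in>sets borel. 0 \<notin> closure B \<longrightarrow> emeasure \<mu> B < \<infinity>) \<and>
    (\<forall>t. 0 < measure M (exceedance M X t)) \<and>
    (\<forall>B\<in>sets borel. 0 \<notin> closure B \<and> emeasure \<mu> (frontier B) = 0 \<longrightarrow>
      ((\<lambda>t. measure M {w \<in> space M. X w /\<^sub>R t \<in> B} / measure M (exceedance M X t))
        \<longlongrightarrow> measure \<mu> B) at_top)"

definition cond_exceed :: "'w measure \<Rightarrow> ('w \<Rightarrow> real^'d) \<Rightarrow> real \<Rightarrow> 'w measure" where
  "cond_exceed M X t = uniform_measure M (exceedance M X t)"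

definition limit_model :: "(real^'d) measure \<Rightarrow> (real^'d) measure" where
  "limit_model \<mu> = restrict_space \<mu> {x. 1 < norm x}"

definition rescaled :: "(real^'d \<Rightarrow> real) \<Rightarrow> real^'d \<Rightarrow> real^'d" where
  "rescaled \<omega> x = \<omega> x *\<^sub>R x"

definition Sigma_cond :: "'w measure \<Rightarrow> ('w \<Rightarrow> real^'d) \<Rightarrow> (real^'d \<Rightarrow> real) \<Rightarrow> real \<Rightarrow> real^'d^'d" where
  "Sigma_cond M X \<omega> t = (\<integral>w. outer_square (rescaled \<omega> (X w)) \<partial>cond_exceed M X t)"

definition Sigma_lim :: "(real^'d) measure \<Rightarrow> (real^'d \<Rightarrow> real) \<Rightarrow> real^'d^'d" where
  "Sigma_lim \<mu> \<omega> = (\<integral>x. outer_square (rescaled \<omega> x) \<partial>limit_model \<mu>)"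

definition threshold :: "'w measure \<Rightarrow> ('w \<Rightarrow> real^'d) \<Rightarrow> nat \<Rightarrow> nat \<Rightarrow> real" where
  "threshold M X n k = quantile M (\<lambda>w. norm (X w)) (1 - real k / real n)"

definition Sigma_nk ::
    "'w measure \<Rightarrow> ('w \<Rightarrow> real^'d) \<Rightarrow> (real^'d \<Rightarrow> real) \<Rightarrow> nat \<Rightarrow> nat \<Rightarrow> real^'d^'d" where
  "Sigma_nk M X \<omega> n k = Sigma_cond M X \<omega> (threshold M X n k)"

section \<open>Risks\<close>

definition risk :: "real^'d^'d \<Rightarrow> (real^'d) set \<Rightarrow> real" where
  "risk S V = trace (S ** proj_matrix V)"

text \<open>The \<open>(k+1)\<close>-th largest of the norms of the observations \<open>Xs 1, \<dots>, Xs n\<close>.\<close>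

definition emp_threshold :: "(nat \<Rightarrow> 'w \<Rightarrow> real^'d) \<Rightarrow> nat \<Rightarrow> nat \<Rightarrow> 'w \<Rightarrow> real" where
  "emp_threshold Xs n k w = rev (sort (map (\<lambda>i. norm (Xs i w)) [1..<n+1])) ! k"

definition emp_risk ::
    "(nat \<Rightarrow> 'w \<Rightarrow> real^'d) \<Rightarrow> (real^'d \<Rightarrow> real) \<Rightarrow> nat \<Rightarrow> nat \<Rightarrow> 'w \<Rightarrow> (real^'d) set \<Rightarrow> real" where
  "emp_risk Xs \<omega> n k w V =
    (1 / real k) * (\<Sum>i=1..n.
      (rescaled \<omega> (Xs i w) \<bullet> (proj_matrix V *v rescaled \<omega> (Xs i w))) *
      of_bool (emp_threshold Xs n k w < norm (Xs i w)))"

definition excess_risk :: "real^'d^'d \<Rightarrow> nat \<Rightarrow> (real^'d) set \<Rightarrow> real" where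
  "excess_risk S p V = (SUP W\<in>subspaces_of_dim p. risk S W) - risk S V"

text \<open>Division on \<^typ>\<open>ereal\<close> satisfies \<open>1 / \<infinity> = 0\<close> and \<open>1 / 0 = \<infinity>\<close>.\<close>

definition gap_rate :: "real^'d^'d \<Rightarrow> nat \<Rightarrow> nat \<Rightarrow> ereal" where
  "gap_rate S k p =
    Min ((\<lambda>(i, j).
        ereal (1 / real k) *
          (1 / (eigval S (i - 1) - eigval S (p + 1)) + 1 / (eigval S p - eigval S j))
        + (eigval S i - eigval S (j - 1)))
      ` ({1..p} \<times> {p+1..CARD('d)+1}))"

end

theory Submission
  imports Defs
begin

text \<open>Let \<open>\<Sigma>\<close> be the conditional second moment matrix at the deterministic threshold, \<open>\<Sigma>'\<close> its empirical
  counterpart, and \<open>P\<close> the projection onto an empirical maximizer. Since \<open>\<Theta>\<close> is bounded, Chebyshev's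
  inequality gives \<open>\<parallel>\<Sigma>' - \<Sigma>\<parallel> = O\<^sub>P(k powr (-1/2))\<close>.

  Fix \<open>i \<le> p < j\<close> and let \<open>\<delta>\<close> be the mass that \<open>P\<close> misplaces on the eigenvectors of \<open>\<Sigma>\<close> with index below
  \<open>i\<close> or at least \<open>j\<close>. The excess risk \<open>L\<close> of \<open>P\<close> dominates \<open>\<delta>\<close> up to the reciprocal gaps \<open>r\<close> that occur in
  the rate, so \<open>\<delta> \<le> r L\<close>. There is a matrix \<open>Q\<close> between 0 and the identity that is diagonal outside the
  block \<open>{i..<j}\<close> and satisfies \<open>\<parallel>P - Q\<parallel>\<^sup>2 \<le> d \<delta>\<close>. Comparing \<open>P\<close> with \<open>Q\<close> under \<open>\<Sigma>'\<close> bounds \<open>L\<close> by a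
  multiple of \<open>\<lambda>\<^sub>i - \<lambda>\<^bsub>j-1\<^esub> + \<parallel>\<Sigma>' - \<Sigma>\<parallel> \<parallel>P - Q\<parallel>\<close>; inserting \<open>\<delta> \<le> r L\<close> and absorbing \<open>L\<close> by the
  arithmetic-geometric mean inequality gives the first rate.

  For the second rate take \<open>{i..<j}\<close> to be either the limiting eigenvalue block of \<open>p\<close>, whose neighbouring
  gaps stay bounded away from 0, or the indices of the eigenvalues within \<open>k powr (-1/2)\<close> of \<open>\<lambda>\<^sub>p\<close>.\<close>

section \<open>Spectral decomposition of symmetric matrices\<close>

lemma outer_square_mult: "outer_square v *v x = (v \<bullet> x) *\<^sub>R v"
  by (simp add: vec_eq_iff outer_square_def matrix_vector_mult_def inner_vec_def
      sum_distrib_left mult_ac)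

lemma inner_outer_square: "A \<bullet> outer_square v = v \<bullet> (A *v v)"
  by (simp add: outer_square_def inner_vec_def matrix_vector_mult_def sum_distrib_left mult_ac)

lemma symmetric_inner_mult:
  fixes A :: "real^'d^'d"
  assumes "transpose A = A"
  shows "x \<bullet> (A *v y) = (A *v x) \<bullet> y"
  by (metis assms dot_lmul_matrix vector_transpose_matrix)

text \<open>The inner product of matrices is the Frobenius one, so \<open>\<bullet> mat 1\<close> is
  the trace; traces are written this way from here on.\<close>

lemma symmetric_mult_self_inner:
  fixes A :: "real^'d^'d"
  assumes "transpose A = A"
  shows "A \<bullet> A = (A ** A) \<bullet> mat 1"
proof -
  have *: "A $ i $ j = A $ j $ i" for i j
    using assms by (metis transpose_def vec_lambda_beta)
  have "A \<bullet> A = (\<Sum>i\<in>UNIV. \<Sum>j\<in>UNIV. A $ i $ j * A $ j $ i)"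
    unfolding inner_vec_def using * by simp
  also have "\<dots> = (A ** A) \<bullet> mat 1"
    by (simp add: inner_vec_def matrix_matrix_mult_def mat_def if_distrib cong: if_cong)
  finally show ?thesis .
qed

text \<open>Turns the risk into a functional that is linear in the matrix and in the
  projection.\<close>

lemma trace_mult_symmetric:
  fixes A B :: "real^'d^'d"
  assumes "transpose B = B"
  shows "trace (A ** B) = A \<bullet> B"
proof -
  have *: "B $ i $ j = B $ j $ i" for i j
    using assms by (metis transpose_def vec_lambda_beta)
  show ?thesis
    unfolding trace_def inner_vec_def matrix_matrix_mult_def using * by simp
qed

section \<open>Orthonormal frames and expansions in them\<close>

definition orthonormal_frame :: "(nat \<Rightarrow> real^'d) \<Rightarrow> bool" where
  "orthonormal_frame u \<longleftrightarrow>
    (\<forall>m\<in>{1..CARD('d)}. \<forall>n\<in>{1..CARD('d)}. u m \<bullet> u n = of_bool (m = n))"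

text \<open>Indices run from 1 and \<open>l\<close> is nonincreasing, to agree with the numbering of
  \<open>eigval\<close>. Values at indices outside \<open>{1..CARD('d)}\<close> are
  unconstrained.\<close>

definition eigenframe :: "real^'d^'d \<Rightarrow> (nat \<Rightarrow> real^'d) \<Rightarrow> (nat \<Rightarrow> real) \<Rightarrow> bool" where
  "eigenframe S u l \<longleftrightarrow> orthonormal_frame u \<and> (\<forall>m\<in>{1..CARD('d)}. S *v u m = l m *\<^sub>R u m) \<and>
    (\<forall>m\<in>{1..CARD('d)}. \<forall>n\<in>{m..CARD('d)}. l n \<le> l m)"

lemma orthonormal_frame_inner:
  fixes u :: "nat \<Rightarrow> real^'d"
  assumes "orthonormal_frame u" "m \<in> {1..CARD('d)}" "n \<in> {1..CARD('d)}"
  shows "u m \<bullet> u n = of_bool (m = n)"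
  using assms unfolding orthonormal_frame_def by blast

text \<open>As many orthonormal vectors as the dimension are independent, hence spanning. The
  residual of the expansion is orthogonal to all of them and so to itself.\<close>

lemma orthonormal_frame_expansion:
  fixes u :: "nat \<Rightarrow> real^'d"
  assumes "orthonormal_frame u"
  shows "x = (\<Sum>m=1..CARD('d). (u m \<bullet> x) *\<^sub>R u m)"
proof -
  let ?d = "CARD('d)"
  have ip: "u m \<bullet> u n = of_bool (m = n)" if "m \<in> {1..?d}" "n \<in> {1..?d}" for m n
    using orthonormal_frame_inner[OF assms] that by blast
  have inj: "inj_on u {1..?d}"
  proof (rule inj_onI)
    fix m n assume "m \<in> {1..?d}" "n \<in> {1..?d}" "u m = u n"
    then show "m = n" using ip[of m n] ip[of m m] by (auto split: if_splits)
  qed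
  have "independent (u ` {1..?d})"
  proof (rule pairwise_orthogonal_independent)
    show "pairwise orthogonal (u ` {1..?d})"
      unfolding pairwise_def orthogonal_def using ip by fastforce
    show "0 \<notin> u ` {1..?d}" using ip by force
  qed
  moreover have "card (u ` {1..?d}) = ?d" using inj by (simp add: card_image)
  ultimately have sp: "span (u ` {1..?d}) = UNIV"
    using card_ge_dim_independent[of "u ` {1..?d}" UNIV] by auto
  define y where "y = x - (\<Sum>m=1..?d. (u m \<bullet> x) *\<^sub>R u m)"
  have "orthogonal y v" if "v \<in> u ` {1..?d}" for v
  proof -
    from that obtain n where n: "n \<in> {1..?d}" "v = u n" by blast
    have "(\<Sum>m=1..?d. (u m \<bullet> x) * (u m \<bullet> u n)) = (\<Sum>m=1..?d. if m = n then u n \<bullet> x else 0)"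
      by (rule sum.cong) (use ip n in auto)
    then have "(\<Sum>m=1..?d. (u m \<bullet> x) * (u m \<bullet> u n)) = u n \<bullet> x" using n by simp
    then show ?thesis
      using n by (simp add: orthogonal_def y_def inner_diff_left inner_sum_left inner_commute[of x])
  qed
  then have "orthogonal y y" using orthogonal_to_span[of y "u ` {1..?d}" y] sp by blast
  then show ?thesis by (simp add: y_def orthogonal_def)
qed

lemma orthonormal_frame_norm2:
  fixes u :: "nat \<Rightarrow> real^'d"
  assumes "orthonormal_frame u"
  shows "x \<bullet> x = (\<Sum>m=1..CARD('d). (u m \<bullet> x)\<^sup>2)"
proof -
  have "x \<bullet> x = x \<bullet> (\<Sum>m=1..CARD('d). (u m \<bullet> x) *\<^sub>R u m)"
    using orthonormal_frame_expansion[OF assms, of x] by simp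
  then show ?thesis by (simp add: inner_sum_right power2_eq_square inner_commute)
qed

lemma sum_matrix_vector_mult: "(\<Sum>i\<in>I. A i) *v x = (\<Sum>i\<in>I. A i *v x)"
  by (induction I rule: infinite_finite_induct) (simp_all add: matrix_vector_mult_add_rdistrib)

lemma orthonormal_frame_identity:
  fixes u :: "nat \<Rightarrow> real^'d"
  assumes "orthonormal_frame u"
  shows "mat 1 = (\<Sum>m=1..CARD('d). outer_square (u m))"
  unfolding matrix_eq
  using orthonormal_frame_expansion[OF assms]
  by (simp add: sum_matrix_vector_mult outer_square_mult)

lemma eigenframe_decomposition:
  fixes S :: "real^'d^'d"
  assumes "eigenframe S u l"
  shows "S = (\<Sum>m=1..CARD('d). l m *\<^sub>R outer_square (u m))"
  unfolding matrix_eq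
proof
  fix x
  have o: "orthonormal_frame u" using assms by (simp add: eigenframe_def)
  have "S *v x = S *v (\<Sum>m=1..CARD('d). (u m \<bullet> x) *\<^sub>R u m)"
    using orthonormal_frame_expansion[OF o, of x] by simp
  also have "\<dots> = (\<Sum>m=1..CARD('d). (u m \<bullet> x) *\<^sub>R (S *v u m))"
    by (simp add: matrix_vector_mult_scaleR linear_sum[OF matrix_vector_mul_linear])
  also have "\<dots> = (\<Sum>m=1..CARD('d). l m *\<^sub>R outer_square (u m)) *v x"
    unfolding sum_matrix_vector_mult
    by (rule sum.cong) (use assms in \<open>auto simp: eigenframe_def outer_square_mult scaleR_matrix_vector_assoc[symmetric]\<close>)
  finally show "S *v x = \<dots>" .
qed

lemma eigenframe_inner:
  fixes S :: "real^'d^'d"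
  assumes "eigenframe S u l"
  shows "S \<bullet> Q = (\<Sum>m=1..CARD('d). l m * (u m \<bullet> (Q *v u m)))"
  by (subst eigenframe_decomposition[OF assms])
    (simp add: inner_sum_left inner_commute[of "outer_square _"] inner_outer_square)

lemma orthonormal_frame_trace:
  fixes u :: "nat \<Rightarrow> real^'d"
  assumes "orthonormal_frame u"
  shows "mat 1 \<bullet> Q = (\<Sum>m=1..CARD('d). u m \<bullet> (Q *v u m))"
  by (subst orthonormal_frame_identity[OF assms])
    (simp add: inner_sum_left inner_commute[of "outer_square _"] inner_outer_square)

text \<open>A maximizer of the Rayleigh quotient on the compact unit sphere of \<open>W\<close> is
  an eigenvector, by the first-order condition; the maximum is the eigenvalue.\<close>

lemma invariant_subspace_max_eigenvector:
  fixes S :: "real^'d^'d"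
  assumes sym: "transpose S = S" and W: "subspace W" and inv: "\<And>w. w \<in> W \<Longrightarrow> S *v w \<in> W"
    and dim: "dim W > 0"
  obtains v a where "v \<in> W" "norm v = 1" "S *v v = a *\<^sub>R v"
    "\<And>w. w \<in> W \<Longrightarrow> w \<bullet> (S *v w) \<le> a * (w \<bullet> w)"
proof -
  have comp: "compact (W \<inter> sphere 0 1)"
    using closed_subspace[OF W] by (simp add: closed_Int_compact)
  obtain w0 where w0: "w0 \<in> W" "w0 \<noteq> 0" 
    using dim by (metis dim_eq_0 less_numeral_extra(3) subsetI singletonI)
  then have "w0 /\<^sub>R norm w0 \<in> W \<inter> sphere 0 1" using W by (simp add: subspace_scale)
  then have ne: "W \<inter> sphere 0 1 \<noteq> {}" by blast
  have "continuous_on (W \<inter> sphere 0 1) (\<lambda>x. x \<bullet> (S *v x))"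
    by (intro continuous_intros)
  from continuous_attains_sup[OF comp ne this] obtain v where
    v: "v \<in> W" "norm v = 1" and mx: "\<And>y. y \<in> W \<Longrightarrow> norm y = 1 \<Longrightarrow> y \<bullet> (S *v y) \<le> v \<bullet> (S *v v)"
    by auto
  define a where "a = v \<bullet> (S *v v)"
  have bd: "w \<bullet> (S *v w) \<le> a * (w \<bullet> w)" if "w \<in> W" for w
  proof (cases "w = 0")
    case False
    define y where "y = w /\<^sub>R norm w"
    have "y \<in> W" "norm y = 1" using that False W by (auto simp: y_def subspace_scale)
    from mx[OF this] have "y \<bullet> (S *v y) \<le> a" by (simp add: a_def)
    moreover have "w = norm w *\<^sub>R y" using False by (simp add: y_def)
    then have "w \<bullet> (S *v w) = (norm w)\<^sup>2 * (y \<bullet> (S *v y))"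
      by (metis inner_scaleR_left inner_scaleR_right matrix_vector_mult_scaleR mult.assoc power2_eq_square)
    ultimately show ?thesis
      by (simp add: power2_norm_eq_inner[symmetric] mult.commute mult_right_mono)
  qed auto
  \<comment> \<open>\<open>z\<close> is the defect in the eigenvector equation. It lies in
    \<open>W\<close> by invariance, so \<open>v\<close> may be varied in its direction; the linear
    coefficient of the resulting nonnegative quadratic in \<open>t\<close> is twice the squared norm
    of \<open>z\<close>.\<close>
  define z where "z = a *\<^sub>R v - S *v v"
  have zW: "z \<in> W" unfolding z_def using v inv W by (simp add: subspace_diff subspace_scale)
  define B where "B = a * (z \<bullet> z) - z \<bullet> (S *v z)"
  have "0 \<le> 2 * t * (z \<bullet> z) + t\<^sup>2 * B" for t
  proof -
    have "v + t *\<^sub>R z \<in> W" using v zW W by (simp add: subspace_add subspace_scale)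
    from bd[OF this]
    have "0 \<le> a * ((v + t *\<^sub>R z) \<bullet> (v + t *\<^sub>R z)) - (v + t *\<^sub>R z) \<bullet> (S *v (v + t *\<^sub>R z))" by simp
    also have "\<dots> = a * (v \<bullet> v) - v \<bullet> (S *v v) + 2 * t * (a * (v \<bullet> z) - (S *v v) \<bullet> z) + t\<^sup>2 * B"
      unfolding B_def
      using symmetric_inner_mult[OF sym, of v z] inner_commute[of z "S *v v"]
      by (simp add: matrix_vector_right_distrib matrix_vector_mult_scaleR inner_add_left inner_add_right
          algebra_simps power2_eq_square inner_commute[of z v])
    also have "a * (v \<bullet> z) - (S *v v) \<bullet> z = z \<bullet> z"
      by (simp add: z_def inner_diff_left inner_diff_right algebra_simps)
    also have "a * (v \<bullet> v) - v \<bullet> (S *v v) = 0" using v by (simp add: a_def dot_square_norm)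
    finally show ?thesis by simp
  qed
  note quad = this
  have "z \<bullet> z = 0"
  proof (rule ccontr)
    assume "z \<bullet> z \<noteq> 0"
    then have zp: "z \<bullet> z > 0" by simp
    \<comment> \<open>Negative, and so small that the quadratic term is at most half the linear one
      in absolute value. The summand 1 keeps the denominator positive when
      \<open>B = 0\<close>.\<close>
    define t where "t = - (z \<bullet> z) / (\<bar>B\<bar> + 1)"
    have t: "t < 0" using zp by (simp add: t_def divide_neg_pos)
    have tb: "\<bar>t\<bar> * \<bar>B\<bar> \<le> z \<bullet> z"
      using zp by (simp add: t_def abs_mult field_simps)
    have "t\<^sup>2 * B \<le> \<bar>t\<bar> * (\<bar>t\<bar> * \<bar>B\<bar>)" 
      by (metis abs_ge_self abs_mult abs_power2 mult.assoc power2_eq_square)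
    also have "\<dots> \<le> \<bar>t\<bar> * (z \<bullet> z)" using tb by (simp add: mult_left_mono)
    finally have "2 * t * (z \<bullet> z) + t\<^sup>2 * B \<le> t * (z \<bullet> z)" using t by simp
    also have "\<dots> < 0" using t zp by (simp add: mult_neg_pos)
    finally show False using quad[of t] by simp
  qed
  then have "S *v v = a *\<^sub>R v" by (simp add: z_def)
  with v bd that show ?thesis by blast
qed

text \<open>Induction on the dimension: split off a maximal eigenvector and continue in its
  orthogonal complement inside \<open>W\<close>, which is invariant because \<open>S\<close> is
  symmetric.\<close>

lemma invariant_subspace_eigenframe:
  fixes S :: "real^'d^'d"
  assumes sym: "transpose S = S"
  shows "subspace W \<Longrightarrow> (\<And>w. w \<in> W \<Longrightarrow> S *v w \<in> W) \<Longrightarrow> dim W = r \<Longrightarrow>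
    \<exists>u l. (\<forall>m\<in>{1..r}. u m \<in> W \<and> S *v u m = l m *\<^sub>R u m) \<and>
      (\<forall>m\<in>{1..r}. \<forall>n\<in>{1..r}. u m \<bullet> u n = of_bool (m = n)) \<and>
      (\<forall>m\<in>{1..r}. \<forall>n\<in>{m..r}. l n \<le> (l m :: real))"
proof (induction r arbitrary: W)
  case 0
  then show ?case by simp
next
  case (Suc r)
  obtain v a where v: "v \<in> W" "norm v = 1" "S *v v = a *\<^sub>R v"
    and mx: "\<And>w. w \<in> W \<Longrightarrow> w \<bullet> (S *v w) \<le> a * (w \<bullet> w)"
    using invariant_subspace_max_eigenvector[OF sym Suc.prems(1,2)] Suc.prems(3) by auto
  define W' where "W' = {y \<in> W. \<forall>x\<in>span {v}. orthogonal x y}"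
  have W'_alt: "W' = {y \<in> W. v \<bullet> y = 0}"
    unfolding W'_def orthogonal_def by (auto simp: span_singleton)
  have "subspace W'" 
    using Suc.prems(1) unfolding W'_alt subspace_def by (auto simp: inner_add_right)
  moreover have "S *v w \<in> W'" if "w \<in> W'" for w
    using that Suc.prems(2) symmetric_inner_mult[OF sym, of v w] v by (simp add: W'_alt)
  moreover have "dim W' = r"
  proof -
    have "dim W' + dim (span {v}) = dim W" unfolding W'_def
      by (rule dim_subspace_orthogonal_to_vectors)
        (use Suc.prems v in \<open>auto simp: span_minimal\<close>)
    moreover have "dim (span {v}) = 1" using v by (auto simp: dim_singleton)
    ultimately show ?thesis using Suc.prems by simp
  qed
  ultimately obtain u l where
    ul: "\<forall>m\<in>{1..r}. u m \<in> W' \<and> S *v u m = l m *\<^sub>R u m"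
    and on: "\<forall>m\<in>{1..r}. \<forall>n\<in>{1..r}. u m \<bullet> u n = of_bool (m = n)"
    and ord: "\<forall>m\<in>{1..r}. \<forall>n\<in>{m..r}. l n \<le> (l m :: real)"
    using Suc.IH by metis
  have shift: "m - 1 \<in> {1..r}" if "m \<in> {1..Suc r}" "m \<noteq> 1" for m
    using that by auto
  \<comment> \<open>Maximality of \<open>a\<close> on all of \<open>W\<close> puts the new
    eigenvalue in front of those found in the complement.\<close>
  have la: "l m \<le> a" if "m \<in> {1..r}" for m
    using mx[of "u m"] ul on that by (auto simp: W'_alt)
  define u' where "u' = (\<lambda>m. if m = 1 then v else u (m - 1))"
  define l' where "l' = (\<lambda>m. if m = 1 then a else l (m - 1))"
  have "\<forall>m\<in>{1..Suc r}. u' m \<in> W \<and> S *v u' m = l' m *\<^sub>R u' m"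
    unfolding u'_def l'_def using ul v shift by (auto simp: W'_alt)
  moreover have "\<forall>m\<in>{1..Suc r}. \<forall>n\<in>{1..Suc r}. u' m \<bullet> u' n = of_bool (m = n)"
  proof (intro ballI)
    fix m n assume mn: "m \<in> {1..Suc r}" "n \<in> {1..Suc r}"
    have "u (m - 1) \<bullet> v = 0" if "m \<in> {1..Suc r}" "m \<noteq> 1" for m
      using ul shift[OF that] by (auto simp: W'_alt inner_commute)
    moreover have "v \<bullet> v = 1" using v by (simp add: dot_square_norm)
    moreover have "m - 1 = n - 1 \<longleftrightarrow> m = n" using mn by auto
    ultimately show "u' m \<bullet> u' n = of_bool (m = n)"
      unfolding u'_def using mn on shift by (auto simp: inner_commute)
  qed
  moreover have "\<forall>m\<in>{1..Suc r}. \<forall>n\<in>{m..Suc r}. l' n \<le> l' m"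
  proof (intro ballI)
    fix m n assume mn: "m \<in> {1..Suc r}" "n \<in> {m..Suc r}"
    show "l' n \<le> l' m"
    proof (cases "m = 1")
      case True
      then show ?thesis unfolding l'_def using mn la[OF shift, of n] by auto
    next
      case False
      then have "n - 1 \<in> {m - 1..r}" "m - 1 \<in> {1..r}" "n \<noteq> 1" using mn by auto
      then show ?thesis unfolding l'_def using False ord by auto
    qed
  qed
  ultimately show ?case by (intro exI[of _ u'] exI[of _ l']) blast
qed

lemma symmetric_eigenframe:
  fixes S :: "real^'d^'d"
  assumes "transpose S = S"
  obtains u l where "eigenframe S u l"
proof -
  have "dim (UNIV :: (real^'d) set) = CARD('d)" by simp
  from invariant_subspace_eigenframe[OF assms _ _ this] 
  show ?thesis using that unfolding eigenframe_def orthonormal_frame_def by auto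
qed

section \<open>Eigenvalues as roots of the characteristic polynomial\<close>

lemma poly_charpoly: "poly (charpoly S) x = det (mat x - S)"
proof -
  have "poly (map_matrix (\<lambda>c. [:c:]) S $ i $ j) x = S $ i $ j" for i j by simp
  then show ?thesis
    unfolding charpoly_def det_def poly_sum
    by (intro sum.cong) (auto simp: poly_prod mat_def intro!: prod.cong)
qed

text \<open>The matrix with the frame vectors as columns diagonalizes \<open>S\<close>, so the
  determinants agree at every real argument. Real polynomials that agree as functions are
  equal.\<close>

lemma charpoly_eigenframe:
  fixes S :: "real^'d^'d"
  assumes "eigenframe S u l"
  shows "charpoly S = (\<Prod>m=1..CARD('d). [:- l m, 1:])"
proof -
  have o: "orthonormal_frame u" using assms by (simp add: eigenframe_def)
  \<comment> \<open>Columns are indexed by the type \<open>'d\<close>, frames by natural numbers;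
    \<open>e\<close> translates.\<close>
  obtain e :: "'d \<Rightarrow> nat" where e: "bij_betw e UNIV {1..CARD('d)}"
    using finite_same_card_bij[of "UNIV :: 'd set" "{1..CARD('d)}"] by auto
  then have eI: "e i \<in> {1..CARD('d)}" for i by (auto simp: bij_betw_def)
  have ei: "e i = e j \<longleftrightarrow> i = j" for i j using e by (auto simp: bij_betw_def inj_on_def)
  define U :: "real^'d^'d" where "U = (\<chi> i j. u (e j) $ i)"
  have "transpose U ** U = mat 1"
  proof -
    have "(\<Sum>k\<in>UNIV. u (e i) $ k * u (e j) $ k) = of_bool (i = j)" for i j
      using orthonormal_frame_inner[OF o eI eI, of i j] by (simp add: inner_vec_def ei)
    then show ?thesis
      by (simp add: vec_eq_iff U_def transpose_def matrix_matrix_mult_def mat_def)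
  qed
  then have "det (transpose U) * det U = 1" by (metis det_mul det_I)
  then have dU: "det U \<noteq> 0" by auto
  have "poly (charpoly S) x = poly (\<Prod>m=1..CARD('d). [:- l m, 1:]) x" for x
  proof -
    define D :: "real^'d^'d" where "D = (\<chi> i j. if i = j then x - l (e j) else 0)"
    have "(mat x - S) ** U = U ** D"
    proof -
      have "(S ** U) $ i $ j = l (e j) * u (e j) $ i" for i j
      proof -
        have "(S ** U) $ i $ j = (S *v u (e j)) $ i"
          by (simp add: matrix_matrix_mult_def matrix_vector_mult_def U_def)
        also have "S *v u (e j) = l (e j) *\<^sub>R u (e j)"
          using assms eI[of j] unfolding eigenframe_def by blast
        finally show ?thesis by simp
      qed
      moreover have "(mat x ** U) $ i $ j = x * u (e j) $ i" for i j
        by (simp add: matrix_matrix_mult_def mat_def U_def if_distrib[of "\<lambda>x. x * _"] cong: if_cong)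
      moreover have "(U ** D) $ i $ j = (x - l (e j)) * u (e j) $ i" for i j
        by (simp add: matrix_matrix_mult_def D_def U_def if_distrib cong: if_cong)
      moreover have "((mat x - S) ** U) $ i $ j = (mat x ** U) $ i $ j - (S ** U) $ i $ j" for i j
        by (simp add: matrix_matrix_mult_def left_diff_distrib sum_subtractf)
      ultimately show ?thesis
        by (simp add: vec_eq_iff left_diff_distrib)
    qed
    then have "det (mat x - S) * det U = det U * det D" by (metis det_mul)
    then have "det (mat x - S) = det D" using dU by simp
    also have "\<dots> = (\<Prod>j\<in>UNIV. x - l (e j))"
      by (subst det_diagonal) (auto simp: D_def)
    also have "\<dots> = (\<Prod>m=1..CARD('d). x - l m)"
      by (rule prod.reindex_bij_betw[OF e])
    finally show ?thesis by (simp add: poly_charpoly poly_prod)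
  qed
  then show ?thesis by (simp add: poly_eq_poly_eq_iff[symmetric] fun_eq_iff)
qed

text \<open>The multiset of roots does not depend on the frame, so every eigenframe lists the same
  eigenvalues. This links the root-based \<open>eigval\<close> to the spectral
  decomposition.\<close>

lemma eigval_eigenframe:
  fixes S :: "real^'d^'d"
  assumes "eigenframe S u l" "m \<in> {1..CARD('d)}"
  shows "eigval S m = ereal (l m)"
proof -
  let ?xs = "map l [1..<CARD('d) + 1]"
  have "proots (charpoly S) = (\<Sum>m\<in>{1..CARD('d)}. {#l m#})"
    unfolding charpoly_eigenframe[OF assms(1)] by (subst proots_prod) auto
  also have "\<dots> = mset ?xs"
  proof -
    have "(\<Sum>m\<in>{1..<n + 1}. {#l m#}) = mset (map l [1..<n + 1])" for n
      by (induction n) auto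
    from this[of "CARD('d)"] show ?thesis by (simp add: atLeastLessThanSuc_atLeastAtMost)
  qed
  finally have "sorted_list_of_multiset (proots (charpoly S)) = sort ?xs"
    by (simp only: sorted_list_of_multiset_mset)
  \<comment> \<open>The list of the \<open>l m\<close> is already nonincreasing, so sorting only
    reverses it.\<close>
  also have "sort ?xs = rev ?xs"
  proof (rule properties_for_sort)
    show "sorted (rev ?xs)"
      unfolding sorted_rev_iff_nth_mono
      using assms(1) by (auto simp: eigenframe_def nth_append simp del: upt_Suc)
  qed simp
  finally have "rev (sorted_list_of_multiset (proots (charpoly S))) ! (m - 1) = ?xs ! (m - 1)"
    by (simp only: rev_rev_ident)
  also have "\<dots> = l m" using assms(2) by (auto simp del: upt_Suc)
  finally show ?thesis using assms(2) by (simp add: eigval_def)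
qed

section \<open>Orthogonal projections\<close>

text \<open>For two candidates the difference of the images of a vector lies in \<open>V\<close> and
  is orthogonal to \<open>V\<close>, hence vanishes; this justifies the definite
  description.\<close>

lemma proj_matrix_eq:
  fixes V :: "(real^'d) set"
  assumes "subspace V" "\<And>x. P *v x \<in> V" "\<And>x v. v \<in> V \<Longrightarrow> orthogonal (x - P *v x) v"
  shows "proj_matrix V = P"
  unfolding proj_matrix_def
proof (rule the_equality)
  show "\<forall>x. P *v x \<in> V \<and> (\<forall>v\<in>V. orthogonal (x - P *v x) v)" using assms by blast
  fix Q assume Q: "\<forall>x. Q *v x \<in> V \<and> (\<forall>v\<in>V. orthogonal (x - Q *v x) v)"
  show "Q = P"
    unfolding matrix_eq
  proof
    fix x
    let ?z = "Q *v x - P *v x"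
    have "?z \<in> V" using assms Q by (simp add: subspace_diff)
    then have "orthogonal (x - P *v x) ?z" "orthogonal (x - Q *v x) ?z" using assms(3) Q by blast+
    then have "orthogonal ((x - P *v x) - (x - Q *v x)) ?z"
      by (simp add: orthogonal_def inner_diff_left)
    then show "Q *v x = P *v x" by (simp add: orthogonal_self)
  qed
qed

lemma proj_matrix_span:
  fixes B :: "(real^'d) set"
  assumes fin: "finite B" and orth: "pairwise orthogonal B" and unit: "\<And>b. b \<in> B \<Longrightarrow> norm b = 1"
  shows "proj_matrix (span B) = (\<Sum>b\<in>B. outer_square b)"
proof (rule proj_matrix_eq)
  have mult: "(\<Sum>b\<in>B. outer_square b) *v x = (\<Sum>b\<in>B. (b \<bullet> x) *\<^sub>R b)" for x
    by (simp add: sum_matrix_vector_mult outer_square_mult)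
  show "(\<Sum>b\<in>B. outer_square b) *v x \<in> span B" for x
    unfolding mult by (intro span_sum span_scale span_base)
  fix x v assume v: "v \<in> span B"
  have "orthogonal (x - (\<Sum>b\<in>B. outer_square b) *v x) c" if c: "c \<in> B" for c
  proof -
    have "(\<Sum>b\<in>B. (b \<bullet> x) * (b \<bullet> c)) = (\<Sum>b\<in>B. if b = c then c \<bullet> x else 0)"
      by (rule sum.cong) (use c orth unit in \<open>auto simp: pairwise_def orthogonal_def dot_square_norm\<close>)
    also have "\<dots> = c \<bullet> x" using c fin by simp
    finally show ?thesis
      by (simp add: orthogonal_def mult inner_diff_left inner_sum_left inner_commute[of x])
  qed
  then show "orthogonal (x - (\<Sum>b\<in>B. outer_square b) *v x) v"
    using orthogonal_to_span[OF v] by blast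
qed auto

text \<open>All three facts are read off from the sum of rank-one matrices over an orthonormal basis
  of \<open>V\<close>.\<close>

lemma proj_matrix_props:
  fixes V :: "(real^'d) set"
  assumes "V \<in> subspaces_of_dim p"
  shows transpose_proj_matrix: "transpose (proj_matrix V) = proj_matrix V"
    and proj_matrix_idem: "proj_matrix V ** proj_matrix V = proj_matrix V"
    and trace_proj_matrix: "mat 1 \<bullet> proj_matrix V = real p"
proof -
  have V: "subspace V" "dim V = p" using assms by (auto simp: subspaces_of_dim_def)
  obtain B where B: "B \<subseteq> V" "pairwise orthogonal B" "\<And>b. b \<in> B \<Longrightarrow> norm b = 1"
    "independent B" "card B = dim V" "span B = V"
    using orthonormal_basis_subspace[OF V(1)] by blast
  have fin: "finite B" using B(4) by (rule independent_imp_finite)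
  have P: "proj_matrix V = (\<Sum>b\<in>B. outer_square b)"
    using proj_matrix_span[OF fin B(2,3)] B(6) by simp
  show "transpose (proj_matrix V) = proj_matrix V"
    unfolding P by (simp add: vec_eq_iff transpose_def outer_square_def mult.commute)
  show "mat 1 \<bullet> proj_matrix V = real p"
    unfolding P using B(3,5) V(2) by (simp add: inner_sum_right inner_outer_square dot_square_norm)
  have "(\<Sum>b\<in>B. outer_square b) *v c = c" if c: "c \<in> B" for c
  proof -
    have "(\<Sum>b\<in>B. (b \<bullet> c) *\<^sub>R b) = (\<Sum>b\<in>B. if b = c then c else 0)"
      by (rule sum.cong) (use c B in \<open>auto simp: pairwise_def orthogonal_def dot_square_norm\<close>)
    also have "\<dots> = c" using c fin by simp
    finally show ?thesis by (simp add: sum_matrix_vector_mult outer_square_mult)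
  qed
  then show "proj_matrix V ** proj_matrix V = proj_matrix V"
    unfolding P matrix_eq 
    by (simp add: matrix_vector_mul_assoc[symmetric] sum_matrix_vector_mult[where A=outer_square and x="_::real^'d"] 
        outer_square_mult linear_sum[OF matrix_vector_mul_linear] matrix_vector_mult_scaleR)
qed

lemma proj_matrix_quadratic:
  fixes V :: "(real^'d) set"
  assumes "V \<in> subspaces_of_dim p"
  shows "x \<bullet> (proj_matrix V *v x) = (proj_matrix V *v x) \<bullet> (proj_matrix V *v x)"
    and "x \<bullet> (proj_matrix V *v x) \<le> x \<bullet> x"
    and "(x - proj_matrix V *v x) \<bullet> (x - proj_matrix V *v x) = x \<bullet> x - x \<bullet> (proj_matrix V *v x)"
proof -
  let ?P = "proj_matrix V"
  have idem: "?P *v (?P *v x) = ?P *v x"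
    using proj_matrix_idem[OF assms] by (simp add: matrix_vector_mul_assoc)
  show 1: "x \<bullet> (?P *v x) = (?P *v x) \<bullet> (?P *v x)"
    using symmetric_inner_mult[OF transpose_proj_matrix[OF assms], of x "?P *v x"] idem by simp
  show 2: "(x - ?P *v x) \<bullet> (x - ?P *v x) = x \<bullet> x - x \<bullet> (?P *v x)"
    using 1 by (simp add: inner_diff_left inner_diff_right inner_commute)
  show "x \<bullet> (?P *v x) \<le> x \<bullet> x"
    using 2 inner_ge_zero[of "x - ?P *v x"] by linarith
qed

text \<open>For a symmetric idempotent matrix the squared Frobenius norm is the trace.\<close>

lemma norm_proj_matrix:
  fixes V :: "(real^'d) set"
  assumes "V \<in> subspaces_of_dim p"
  shows "(norm (proj_matrix V))\<^sup>2 = real p"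
proof -
  have "proj_matrix V \<bullet> proj_matrix V = (proj_matrix V ** proj_matrix V) \<bullet> mat 1"
    by (rule symmetric_mult_self_inner[OF transpose_proj_matrix[OF assms]])
  also have "\<dots> = mat 1 \<bullet> proj_matrix V"
    unfolding proj_matrix_idem[OF assms] by (rule inner_commute)
  finally show ?thesis by (simp only: power2_norm_eq_inner trace_proj_matrix[OF assms])
qed

lemma subspaces_of_dim_le: "V \<in> subspaces_of_dim p \<Longrightarrow> p \<le> CARD('d)" for V :: "(real^'d) set"
  using dim_subset_UNIV[of V] by (auto simp: subspaces_of_dim_def)

lemma norm_proj_matrix_le:
  fixes V :: "(real^'d) set"
  assumes "V \<in> subspaces_of_dim p"
  shows "norm (proj_matrix V) \<le> real CARD('d)"
proof -
  have "(norm (proj_matrix V))\<^sup>2 \<le> real CARD('d)"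
    using norm_proj_matrix[OF assms] subspaces_of_dim_le[OF assms] by simp
  also have "\<dots> \<le> (real CARD('d))\<^sup>2" by (simp add: power2_eq_square)
  finally show ?thesis by (rule power2_le_imp_le) simp
qed

text \<open>A Ky Fan inequality for all symmetric \<open>Q\<close> between 0 and the identity. Subtracting the multiple
  \<open>l p\<close> of the identity removes the trace constraint that the usual form needs.\<close>

lemma ky_fan_relaxed:
  fixes S Q :: "real^'d^'d"
  assumes S: "eigenframe S u l" and p: "p \<in> {1..CARD('d)}"
    and Q: "\<And>x. 0 \<le> x \<bullet> (Q *v x)" "\<And>x. x \<bullet> (Q *v x) \<le> x \<bullet> x"
  shows "S \<bullet> Q - l p * (mat 1 \<bullet> Q) \<le> (\<Sum>m=1..p. l m) - real p * l p"
proof -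
  have o: "orthonormal_frame u" using S by (simp add: eigenframe_def)
  have "S \<bullet> Q - l p * (mat 1 \<bullet> Q) = (\<Sum>m=1..CARD('d). (l m - l p) * (u m \<bullet> (Q *v u m)))"
    unfolding eigenframe_inner[OF S] orthonormal_frame_trace[OF o]
    by (simp add: sum_distrib_left sum_subtractf left_diff_distrib)
  \<comment> \<open>The coefficients \<open>l m - l p\<close> change sign at \<open>p\<close>, and
    the weights lie in the unit interval. Weight 1 up to \<open>p\<close> and 0 afterwards is
    therefore best term by term.\<close>
  also have "\<dots> \<le> (\<Sum>m=1..CARD('d). if m \<le> p then l m - l p else 0)"
  proof (rule sum_mono)
    fix m assume m: "m \<in> {1..CARD('d)}"
    have q: "0 \<le> u m \<bullet> (Q *v u m)" "u m \<bullet> (Q *v u m) \<le> 1"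
      using Q[of "u m"] orthonormal_frame_inner[OF o m m] by simp_all
    show "(l m - l p) * (u m \<bullet> (Q *v u m)) \<le> (if m \<le> p then l m - l p else 0)"
    proof (cases "m \<le> p")
      case True
      then have "l p \<le> l m" using S m p by (auto simp: eigenframe_def)
      then show ?thesis using True q mult_left_mono[of "u m \<bullet> (Q *v u m)" 1 "l m - l p"] by simp
    next
      case False
      then have "l m \<le> l p" using S m p by (auto simp: eigenframe_def)
      then show ?thesis using False q by (simp add: mult_nonpos_nonneg)
    qed
  qed
  also have "\<dots> = (\<Sum>m=1..p. l m - l p)"
    by (rule sum.mono_neutral_cong_right) (use p in auto)
  finally show ?thesis by (simp add: sum_subtractf)
qed

section \<open>The Ky Fan variational principle over subspaces\<close>

lemma ky_fan:
  fixes S :: "real^'d^'d"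
  assumes S: "eigenframe S u l" and V: "V \<in> subspaces_of_dim p"
  shows "S \<bullet> proj_matrix V \<le> (\<Sum>m=1..p. l m)"
proof (cases "p = 0")
  \<comment> \<open>The relaxed inequality refers to \<open>l p\<close> and so needs a positive
    index; for dimension 0 the projection has norm 0.\<close>
  case True
  then show ?thesis using norm_proj_matrix[OF V] by simp
next
  case False
  then show ?thesis
    using ky_fan_relaxed[OF S, of p "proj_matrix V"] proj_matrix_quadratic[OF V] trace_proj_matrix[OF V]
      subspaces_of_dim_le[OF V]
    by (simp add: mult.commute)
qed

text \<open>The span of the first \<open>p\<close> frame vectors attains the bound, so the supremum
  in the excess risk is a maximum.\<close>

lemma ky_fan_attained:
  fixes S :: "real^'d^'d"
  assumes S: "eigenframe S u l" and p: "p \<le> CARD('d)"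
  obtains V where "V \<in> subspaces_of_dim p" "S \<bullet> proj_matrix V = (\<Sum>m=1..p. l m)"
proof
  have o: "orthonormal_frame u" using S by (simp add: eigenframe_def)
  have ip: "u m \<bullet> u n = of_bool (m = n)" if "m \<in> {1..p}" "n \<in> {1..p}" for m n
    using orthonormal_frame_inner[OF o] that p by simp
  have inj: "inj_on u {1..p}"
  proof (rule inj_onI)
    fix m n assume "m \<in> {1..p}" "n \<in> {1..p}" "u m = u n"
    then show "m = n" using ip[of m n] ip[of m m] by (auto split: if_splits)
  qed
  have orth: "pairwise orthogonal (u ` {1..p})"
    unfolding pairwise_def orthogonal_def using ip by fastforce
  have unit: "norm b = 1" if "b \<in> u ` {1..p}" for b
    using that ip by (auto simp: norm_eq_1)
  have "independent (u ` {1..p})"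
    by (rule pairwise_orthogonal_independent[OF orth]) (use unit in force)
  then have "dim (span (u ` {1..p})) = p"
    using inj by (simp add: dim_eq_card_independent card_image)
  then show "span (u ` {1..p}) \<in> subspaces_of_dim p"
    by (simp add: subspaces_of_dim_def)
  have "proj_matrix (span (u ` {1..p})) = (\<Sum>m=1..p. outer_square (u m))"
    using proj_matrix_span[OF _ orth unit] inj by (simp add: sum.reindex)
  moreover have "u m \<bullet> (S *v u m) = l m" if "m \<in> {1..p}" for m
    using S p that ip[of m m] by (simp add: eigenframe_def)
  ultimately show "S \<bullet> proj_matrix (span (u ` {1..p})) = (\<Sum>m=1..p. l m)"
    by (simp add: inner_sum_right inner_outer_square)
qed

lemma excess_risk_eq:
  fixes S :: "real^'d^'d"
  assumes S: "eigenframe S u l" and V: "V \<in> subspaces_of_dim p"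
  shows "excess_risk S p V = (\<Sum>m=1..p. l m) - S \<bullet> proj_matrix V"
proof -
  have r: "risk S W = S \<bullet> proj_matrix W" if "W \<in> subspaces_of_dim p" for W
    unfolding risk_def by (rule trace_mult_symmetric[OF transpose_proj_matrix[OF that]])
  obtain W where W: "W \<in> subspaces_of_dim p" "S \<bullet> proj_matrix W = (\<Sum>m=1..p. l m)"
    using ky_fan_attained[OF S subspaces_of_dim_le[OF V]] .
  have "(SUP W\<in>subspaces_of_dim p. risk S W) = (\<Sum>m=1..p. l m)"
    by (rule cSup_eq_maximum) (use W r ky_fan[OF S] in \<open>force+\<close>)
  then show ?thesis using r[OF V] by (simp add: excess_risk_def)
qed

section \<open>Stability of eigenvalues under perturbation\<close>

lemma ky_fan_sum_lipschitz:
  fixes S T :: "real^'d^'d"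
  assumes S: "eigenframe S u l" and T: "eigenframe T v m" and p: "p \<le> CARD('d)"
  shows "(\<Sum>i=1..p. l i) - (\<Sum>i=1..p. m i) \<le> real CARD('d) * norm (S - T)"
proof -
  \<comment> \<open>A subspace optimal for \<open>S\<close> is a competitor for \<open>T\<close>;
    the exchange costs the Frobenius product of \<open>S - T\<close> with one projection.\<close>
  obtain V where V: "V \<in> subspaces_of_dim p" "S \<bullet> proj_matrix V = (\<Sum>m=1..p. l m)"
    using ky_fan_attained[OF S p] .
  have "S \<bullet> proj_matrix V = T \<bullet> proj_matrix V + (S - T) \<bullet> proj_matrix V"
    by (simp add: inner_diff_left)
  also have "\<dots> \<le> (\<Sum>i=1..p. m i) + norm (S - T) * norm (proj_matrix V)"
    using ky_fan[OF T V(1)] norm_cauchy_schwarz by (rule add_mono)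
  also have "\<dots> \<le> (\<Sum>i=1..p. m i) + norm (S - T) * real CARD('d)"
    using norm_proj_matrix_le[OF V(1)] by (simp add: mult_left_mono)
  finally show ?thesis using V(2) by (simp add: mult.commute)
qed

text \<open>An eigenvalue is the difference of two consecutive Ky Fan sums, each Lipschitz with
  constant the dimension; hence the factor 2.\<close>

lemma eigenvalue_lipschitz:
  fixes S T :: "real^'d^'d"
  assumes S: "eigenframe S u l" and T: "eigenframe T v m" and p: "p \<in> {1..CARD('d)}"
  shows "\<bar>l p - m p\<bar> \<le> 2 * real CARD('d) * norm (S - T)"
proof -
  obtain q where q: "p = Suc q" using p by (cases p) auto
  have "l p - m p = ((\<Sum>i=1..p. l i) - (\<Sum>i=1..p. m i)) - ((\<Sum>i=1..q. l i) - (\<Sum>i=1..q. m i))"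
    by (simp add: q)
  moreover have "norm (T - S) = norm (S - T)" by (rule norm_minus_commute)
  ultimately show ?thesis
    using ky_fan_sum_lipschitz[OF S T, of p] ky_fan_sum_lipschitz[OF T S, of p]
      ky_fan_sum_lipschitz[OF S T, of q] ky_fan_sum_lipschitz[OF T S, of q] p q
    by (auto simp: abs_le_iff)
qed

section \<open>Excess risk of a perturbed maximizer\<close>

text \<open>Because the trace of \<open>P\<close> is \<open>p\<close>, replacing \<open>S\<close> by
  \<open>S\<close> minus \<kappa> times the identity lowers both terms of the excess equally. The
  free \<kappa> is later set to \<open>l (p + 1)\<close> or \<open>l p\<close>, which makes all
  summands nonnegative.\<close>

lemma excess_decomposition:
  fixes S P :: "real^'d^'d" and \<kappa> :: real
  assumes S: "eigenframe S u l" and tr: "mat 1 \<bullet> P = real p" and p: "p \<le> CARD('d)"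
  shows "(\<Sum>m=1..p. l m) - S \<bullet> P = (\<Sum>m=1..CARD('d).
    if m \<le> p then (l m - \<kappa>) * (1 - u m \<bullet> (P *v u m)) else (\<kappa> - l m) * (u m \<bullet> (P *v u m)))"
proof -
  have o: "orthonormal_frame u" using S by (simp add: eigenframe_def)
  let ?q = "\<lambda>m. u m \<bullet> (P *v u m)"
  have "(\<Sum>m=1..CARD('d). if m \<le> p then (l m - \<kappa>) * (1 - ?q m) else (\<kappa> - l m) * ?q m)
      = (\<Sum>m=1..CARD('d). (if m \<le> p then l m - \<kappa> else 0) - (l m - \<kappa>) * ?q m)"
    by (rule sum.cong) (auto simp: algebra_simps)
  also have "\<dots> = (\<Sum>m=1..CARD('d). if m \<le> p then l m - \<kappa> else 0) - (\<Sum>m=1..CARD('d). (l m - \<kappa>) * ?q m)"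
    by (rule sum_subtractf)
  also have "(\<Sum>m=1..CARD('d). if m \<le> p then l m - \<kappa> else 0) = (\<Sum>m=1..p. l m - \<kappa>)"
    by (rule sum.mono_neutral_cong_right) (use p in auto)
  also have "\<dots> = (\<Sum>m=1..p. l m) - real p * \<kappa>" by (simp add: sum_subtractf)
  also have "(\<Sum>m=1..CARD('d). (l m - \<kappa>) * ?q m) = S \<bullet> P - \<kappa> * (mat 1 \<bullet> P)"
    unfolding eigenframe_inner[OF S] orthonormal_frame_trace[OF o]
    by (simp add: sum_distrib_left sum_subtractf left_diff_distrib)
  finally show ?thesis using tr by simp
qed

section \<open>Matrices expressed in an orthonormal frame\<close>

lemma norm_mat_1: "norm (mat 1 :: real^'d^'d) \<le> real CARD('d)"
proof -
  have "(norm (mat 1 :: real^'d^'d))\<^sup>2 = real CARD('d)"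
    by (simp add: power2_norm_eq_inner inner_vec_def mat_def if_distrib[of "\<lambda>x. x * _"] cong: if_cong)
  also have "\<dots> \<le> (real CARD('d))\<^sup>2" by (simp add: power2_eq_square)
  finally show ?thesis by (rule power2_le_imp_le) simp
qed

lemma transpose_add: "transpose (A + B) = transpose A + transpose B"
  by (simp add: vec_eq_iff transpose_def)

lemma transpose_diff: "transpose (A - B) = transpose A - (transpose B :: real^'d^'d)"
  by (simp add: vec_eq_iff transpose_def)

lemma transpose_sum_outer_square:
  "transpose (\<Sum>m\<in>I. outer_square (u m)) = (\<Sum>m\<in>I. outer_square (u m))"
  by (simp add: vec_eq_iff transpose_def outer_square_def mult.commute)

lemma frame_sum_outer_square_mult:
  fixes u :: "nat \<Rightarrow> real^'d"
  assumes "orthonormal_frame u" "I \<subseteq> {1..CARD('d)}" "m \<in> {1..CARD('d)}"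
  shows "(\<Sum>n\<in>I. outer_square (u n)) *v u m = (if m \<in> I then u m else 0)"
proof -
  have fin: "finite I" using assms(2) by (rule finite_subset) simp
  have "(\<Sum>n\<in>I. outer_square (u n)) *v u m = (\<Sum>n\<in>I. if n = m then u m else 0)"
    unfolding sum_matrix_vector_mult outer_square_mult
    by (rule sum.cong) (use assms orthonormal_frame_inner[OF assms(1), of _ m] in auto)
  also have "\<dots> = (if m \<in> I then u m else 0)" using fin by simp
  finally show ?thesis .
qed

lemma frame_sum_outer_square_inner:
  "x \<bullet> ((\<Sum>n\<in>I. outer_square (u n)) *v x) = (\<Sum>n\<in>I. (u n \<bullet> x)\<^sup>2)"
  by (simp add: sum_matrix_vector_mult outer_square_mult inner_sum_right power2_eq_square inner_commute)

lemma frame_norm_eq: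
  fixes u :: "nat \<Rightarrow> real^'d"
  assumes u: "orthonormal_frame u" and D: "transpose D = D"
  shows "(norm D)\<^sup>2 = (\<Sum>m=1..CARD('d). (norm (D *v u m))\<^sup>2)"
proof -
  have "(norm D)\<^sup>2 = mat 1 \<bullet> (D ** D)"
    unfolding power2_norm_eq_inner by (subst symmetric_mult_self_inner[OF D]) (rule inner_commute)
  also have "\<dots> = (\<Sum>m=1..CARD('d). u m \<bullet> (D *v (D *v u m)))"
    unfolding orthonormal_frame_trace[OF u] by (simp only: matrix_vector_mul_assoc)
  also have "\<dots> = (\<Sum>m=1..CARD('d). (norm (D *v u m))\<^sup>2)"
    by (simp only: symmetric_inner_mult[OF D] power2_norm_eq_inner)
  finally show ?thesis .
qed

text \<open>Given a projection \<open>P\<close>, the comparison matrix \<open>Q\<close> keeps the leading eigenvectors, drops the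
  trailing ones, and coincides with \<open>P\<close> on the block \<open>{i..<j}\<close>. Its distance to \<open>P\<close> is controlled by the
  mass \<open>P\<close> misplaces outside that block.\<close>

lemma block_compression:
  fixes u :: "nat \<Rightarrow> real^'d" and V :: "(real^'d) set" and i j p :: nat
  defines "P \<equiv> proj_matrix V"
  defines "\<delta> \<equiv> (\<Sum>n=1..CARD('d). if n < i then 1 - u n \<bullet> (P *v u n)
             else if j \<le> n then u n \<bullet> (P *v u n) else 0)"
  assumes u: "orthonormal_frame u" and V: "V \<in> subspaces_of_dim p"
    and i: "1 \<le> i" and ij: "i \<le> j" and j: "j \<le> CARD('d) + 1"
  obtains Q :: "real^'d^'d" where
    "\<And>x. 0 \<le> x \<bullet> (Q *v x)" "\<And>x. x \<bullet> (Q *v x) \<le> x \<bullet> x"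
    "\<And>m. m \<in> {1..CARD('d)} \<Longrightarrow>
      u m \<bullet> (Q *v u m) = (if m < i then 1 else if j \<le> m then 0 else u m \<bullet> (P *v u m))"
    "norm (P - Q) \<le> sqrt (real CARD('d) * \<delta>)"
proof
  let ?d = "CARD('d)"
  let ?q = "\<lambda>m. u m \<bullet> (P *v u m)"
  have ip: "u m \<bullet> u n = of_bool (m = n)" if "m \<in> {1..?d}" "n \<in> {1..?d}" for m n
    using orthonormal_frame_inner[OF u] that by blast
  note quad = proj_matrix_quadratic[OF V, folded P_def]
  have symP: "transpose P = P" unfolding P_def by (rule transpose_proj_matrix[OF V])
  \<comment> \<open>\<open>Pa\<close> projects onto the leading eigenvectors and \<open>Pb\<close>
    onto the block; \<open>Q\<close> compresses \<open>P\<close> to the block and adds the leading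
    projection.\<close>
  define Pa where "Pa = (\<Sum>n\<in>{1..<i}. outer_square (u n))"
  define Pb where "Pb = (\<Sum>n\<in>{i..<j}. outer_square (u n))"
  define Q where "Q = Pa + Pb ** P ** Pb"
  have symb: "transpose Pb = Pb" unfolding Pb_def by (rule transpose_sum_outer_square)
  have syma: "transpose Pa = Pa" unfolding Pa_def by (rule transpose_sum_outer_square)
  have a: "Pa *v u m = (if m < i then u m else 0)" if "m \<in> {1..?d}" for m
    unfolding Pa_def by (subst frame_sum_outer_square_mult[OF u _ that]) (use that ij j in auto)
  have b: "Pb *v u m = (if i \<le> m \<and> m < j then u m else 0)" if "m \<in> {1..?d}" for m
    unfolding Pb_def by (subst frame_sum_outer_square_mult[OF u _ that]) (use that i j in auto)
  have Qx: "Q *v x = Pa *v x + Pb *v (P *v (Pb *v x))" for x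
    by (simp add: Q_def matrix_vector_mult_add_rdistrib matrix_vector_mul_assoc matrix_mul_assoc)
  have quadQ: "x \<bullet> (Q *v x) = x \<bullet> (Pa *v x) + (Pb *v x) \<bullet> (P *v (Pb *v x))" for x
    by (simp add: Qx inner_add_right symmetric_inner_mult[OF symb])
  have Pa_ge: "0 \<le> x \<bullet> (Pa *v x)" for x
    unfolding Pa_def frame_sum_outer_square_inner by (rule sum_nonneg) simp
  show "0 \<le> x \<bullet> (Q *v x)" for x
    unfolding quadQ using Pa_ge[of x] quad(1)[of "Pb *v x"] by simp
  show "x \<bullet> (Q *v x) \<le> x \<bullet> x" for x
  proof -
    have "Pb *v (Pb *v x) = Pb *v x"
    proof -
      have "Pb *v (Pb *v x) = (\<Sum>n\<in>{i..<j}. (u n \<bullet> x) *\<^sub>R (Pb *v u n))"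
        by (subst (2) Pb_def) (simp add: sum_matrix_vector_mult outer_square_mult
            linear_sum[OF matrix_vector_mul_linear] matrix_vector_mult_scaleR)
      also have "\<dots> = (\<Sum>n\<in>{i..<j}. (u n \<bullet> x) *\<^sub>R u n)"
        by (rule sum.cong) (use b i j in auto)
      also have "\<dots> = Pb *v x"
        by (simp add: Pb_def sum_matrix_vector_mult outer_square_mult)
      finally show ?thesis .
    qed
    then have "(Pb *v x) \<bullet> (Pb *v x) = x \<bullet> (Pb *v x)"
      using symmetric_inner_mult[OF symb, of x "Pb *v x"] by simp
    \<comment> \<open>On the block \<open>P\<close> is at most the identity; \<open>Pa\<close> and
      \<open>Pb\<close> involve disjoint index sets, so together they are at most the
      identity.\<close>
    then have "x \<bullet> (Q *v x) \<le> x \<bullet> (Pa *v x) + x \<bullet> (Pb *v x)"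
      unfolding quadQ using quad(2)[of "Pb *v x"] by simp
    also have "\<dots> = (\<Sum>n\<in>{1..<i} \<union> {i..<j}. (u n \<bullet> x)\<^sup>2)"
      unfolding Pa_def Pb_def frame_sum_outer_square_inner
      by (rule sum.union_disjoint[symmetric]) auto
    also have "\<dots> \<le> (\<Sum>n=1..?d. (u n \<bullet> x)\<^sup>2)"
      by (rule sum_mono2) (use i ij j in auto)
    also have "\<dots> = x \<bullet> x" by (rule orthonormal_frame_norm2[OF u, symmetric])
    finally show ?thesis .
  qed
  show "u m \<bullet> (Q *v u m) = (if m < i then 1 else if j \<le> m then 0 else ?q m)"
    if m: "m \<in> {1..?d}" for m
    unfolding quadQ a[OF m] b[OF m] using ip[OF m m] ij by auto
  define D where "D = P - Q"
  have symD: "transpose D = D"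
    unfolding D_def Q_def
    by (simp add: transpose_diff transpose_add matrix_transpose_mul symP syma symb matrix_mul_assoc)
  define e where "e = (\<lambda>n. if n < i then 1 - ?q n else if j \<le> n then ?q n else 0)"
  have e_ge: "0 \<le> e n" if "n \<in> {1..?d}" for n
    unfolding e_def using quad(1,2)[of "u n"] ip[OF that that] by auto
  have \<delta>: "\<delta> = (\<Sum>n=1..?d. e n)" unfolding \<delta>_def e_def ..
  have e_le: "e n \<le> \<delta>" if "n \<in> {1..?d}" for n
    unfolding \<delta> by (rule member_le_sum) (use that e_ge in auto)
  \<comment> \<open>The Frobenius norm of \<open>P - Q\<close> is computed columnwise in the frame.
    A column outside the block is exactly the misplaced mass at its own index.\<close>
  have Dm: "(norm (D *v u m))\<^sup>2 \<le> \<delta>" if m: "m \<in> {1..?d}" for m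
  proof -
    have Du: "D *v u m = P *v u m - Q *v u m"
      by (simp add: D_def matrix_vector_mult_diff_rdistrib)
    consider "m < i" | "j \<le> m" | "i \<le> m" "m < j" by linarith
    then show ?thesis
    proof cases
      case 1
      then have "D *v u m = P *v u m - u m" using Du a[OF m] b[OF m] by (simp add: Qx)
      then have "norm (D *v u m) = norm (u m - P *v u m)" by (simp add: norm_minus_commute)
      then have "(norm (D *v u m))\<^sup>2 = e m"
        using quad(3)[of "u m"] ip[OF m m] 1 by (simp add: power2_norm_eq_inner e_def)
      then show ?thesis using e_le[OF m] by simp
    next
      case 2
      then have "D *v u m = P *v u m" using Du a[OF m] b[OF m] ij by (simp add: Qx)
      then have "(norm (D *v u m))\<^sup>2 = e m"
        using quad(1)[of "u m"] 2 ij by (simp add: power2_norm_eq_inner e_def)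
      then show ?thesis using e_le[OF m] by simp
    next
      case 3
      \<comment> \<open>For a block column the compression removes all coefficients inside the
        block. Those outside are products of \<open>u m\<close> with the misplaced part of
        \<open>u n\<close>, bounded by \<open>e n\<close> through Cauchy-Schwarz.\<close>
      then have Du': "D *v u m = P *v u m - Pb *v (P *v u m)"
        using Du a[OF m] b[OF m] by (simp add: Qx)
      have "(u n \<bullet> (D *v u m))\<^sup>2 \<le> e n" if n: "n \<in> {1..?d}" for n
      proof -
        have un: "u n \<bullet> (D *v u m) = u n \<bullet> (P *v u m) - (Pb *v u n) \<bullet> (P *v u m)"
          unfolding Du' inner_diff_right symmetric_inner_mult[OF symb] ..
        have PP: "u n \<bullet> (P *v u m) = (P *v u n) \<bullet> u m" by (rule symmetric_inner_mult[OF symP])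
        consider "n < i" | "j \<le> n" | "i \<le> n" "n < j" by linarith
        then show ?thesis
        proof cases
          case 1
          then have "u n \<bullet> (D *v u m) = - ((u n - P *v u n) \<bullet> u m)"
            using un b[OF n] PP ip[OF n m] 3 by (simp add: inner_diff_left)
          then have "(u n \<bullet> (D *v u m))\<^sup>2 \<le> ((u n - P *v u n) \<bullet> (u n - P *v u n)) * (u m \<bullet> u m)"
            using Cauchy_Schwarz_ineq[of "u n - P *v u n" "u m"] by simp
          then show ?thesis using quad(3)[of "u n"] ip[OF m m] ip[OF n n] 1 by (simp add: e_def)
        next
          case 2
          then have "u n \<bullet> (D *v u m) = (P *v u n) \<bullet> u m"
            using un b[OF n] PP by simp
          then have "(u n \<bullet> (D *v u m))\<^sup>2 \<le> ((P *v u n) \<bullet> (P *v u n)) * (u m \<bullet> u m)"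
            using Cauchy_Schwarz_ineq[of "P *v u n" "u m"] by simp
          then show ?thesis using quad(1)[of "u n"] ip[OF m m] 2 ij by (simp add: e_def)
        next
          case 3
          then show ?thesis using un b[OF n] by (simp add: e_def)
        qed
      qed
      then have "(\<Sum>n=1..?d. (u n \<bullet> (D *v u m))\<^sup>2) \<le> \<delta>" unfolding \<delta> by (rule sum_mono)
      then show ?thesis
        by (simp only: power2_norm_eq_inner orthonormal_frame_norm2[OF u, of "D *v u m", symmetric])
    qed
  qed
  have "(norm D)\<^sup>2 \<le> (\<Sum>m=1..?d. \<delta>)"
    unfolding frame_norm_eq[OF u symD] by (rule sum_mono) (rule Dm)
  then show "norm (P - Q) \<le> sqrt (real ?d * \<delta>)"
    unfolding D_def by (intro real_le_rsqrt) simp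
qed

text \<open>Each misplaced unit of mass costs at least the corresponding gap. The reciprocal gaps
  enter as \<open>1 \<le> r * gap\<close>, conditional on the neighbour existing, so that
  \<open>r = 0\<close> is admissible at the boundary, in line with the convention that the
  reciprocal of infinity is 0.\<close>

lemma excess_gap_bound:
  fixes S :: "real^'d^'d" and V :: "(real^'d) set"
  defines "P \<equiv> proj_matrix V"
  assumes S: "eigenframe S u l" and V: "V \<in> subspaces_of_dim p" and p: "p \<in> {1..CARD('d) - 1}"
    and i: "i \<in> {1..p}" and j: "j \<in> {p+1..CARD('d)+1}"
    and r1: "0 \<le> r1" "1 < i \<Longrightarrow> 1 \<le> r1 * (l (i - 1) - l (p + 1))"
    and r2: "0 \<le> r2" "j \<le> CARD('d) \<Longrightarrow> 1 \<le> r2 * (l p - l j)"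
  shows "(\<Sum>n=1..CARD('d). if n < i then 1 - u n \<bullet> (P *v u n)
             else if j \<le> n then u n \<bullet> (P *v u n) else 0)
    \<le> (r1 + r2) * ((\<Sum>m=1..p. l m) - S \<bullet> P)"
proof -
  let ?d = "CARD('d)"
  let ?q = "\<lambda>m. u m \<bullet> (P *v u m)"
  define L where "L = (\<Sum>m=1..p. l m) - S \<bullet> P"
  have o: "orthonormal_frame u" using S by (simp add: eigenframe_def)
  have ord: "l n \<le> l m" if "1 \<le> m" "m \<le> n" "n \<le> ?d" for m n
    using S that by (auto simp: eigenframe_def)
  have q: "0 \<le> ?q m" "?q m \<le> 1" if "m \<in> {1..?d}" for m
    using proj_matrix_quadratic(1,2)[OF V, folded P_def, of "u m"] orthonormal_frame_inner[OF o that that]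
    by auto
  have pd: "p \<le> ?d" "p + 1 \<le> ?d" using p by auto
  note dec = excess_decomposition[OF S trace_proj_matrix[OF V, folded P_def] pd(1), folded L_def]
  \<comment> \<open>The decomposition with \<kappa> equal to \<open>l (p + 1)\<close>: indices below
    \<open>i\<close> carry weights of at least \<open>l (i - 1) - l (p + 1)\<close>.\<close>
  have "(\<Sum>n=1..?d. if n < i then 1 - ?q n else 0) \<le> r1 * L"
  proof -
    have "(\<Sum>n=1..?d. if n < i then 1 - ?q n else 0)
      \<le> (\<Sum>n=1..?d. r1 * (if n \<le> p then (l n - l (p+1)) * (1 - ?q n) else (l (p+1) - l n) * ?q n))"
    proof (rule sum_mono)
      fix n assume n: "n \<in> {1..?d}"
      show "(if n < i then 1 - ?q n else 0)
        \<le> r1 * (if n \<le> p then (l n - l (p+1)) * (1 - ?q n) else (l (p+1) - l n) * ?q n)"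
      proof (cases "n < i")
        case True
        then have "1 \<le> r1 * (l (i - 1) - l (p + 1))" using r1(2) n by auto
        also have "\<dots> \<le> r1 * (l n - l (p + 1))"
          using ord[of n "i - 1"] True n i pd by (intro mult_left_mono r1) auto
        finally have "1 * (1 - ?q n) \<le> r1 * (l n - l (p + 1)) * (1 - ?q n)"
          by (rule mult_right_mono) (use q[OF n] in auto)
        then show ?thesis using True i by (simp add: mult.assoc)
      next
        case False
        then show ?thesis
          using q[OF n] ord[of n "p+1"] ord[of "p+1" n] n pd
          by (auto intro!: mult_nonneg_nonneg r1(1))
      qed
    qed
    then show ?thesis unfolding dec[of "l (p+1)"] by (simp add: sum_distrib_left)
  qed
  \<comment> \<open>The decomposition with \<kappa> equal to \<open>l p\<close>: indices from
    \<open>j\<close> on carry weights of at least \<open>l p - l j\<close>.\<close>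
  moreover have "(\<Sum>n=1..?d. if j \<le> n then ?q n else 0) \<le> r2 * L"
  proof -
    have "(\<Sum>n=1..?d. if j \<le> n then ?q n else 0)
      \<le> (\<Sum>n=1..?d. r2 * (if n \<le> p then (l n - l p) * (1 - ?q n) else (l p - l n) * ?q n))"
    proof (rule sum_mono)
      fix n assume n: "n \<in> {1..?d}"
      show "(if j \<le> n then ?q n else 0)
        \<le> r2 * (if n \<le> p then (l n - l p) * (1 - ?q n) else (l p - l n) * ?q n)"
      proof (cases "j \<le> n")
        case True
        then have "1 \<le> r2 * (l p - l j)" using r2(2) n by auto
        also have "\<dots> \<le> r2 * (l p - l n)"
          using ord[of j n] True n j pd by (intro mult_left_mono r2) auto
        finally have "1 * ?q n \<le> r2 * (l p - l n) * ?q n"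
          by (rule mult_right_mono) (use q[OF n] in auto)
        then show ?thesis using True j by (simp add: mult.assoc)
      next
        case False
        then show ?thesis
          using q[OF n] ord[of n p] ord[of p n] n pd p
          by (auto intro!: mult_nonneg_nonneg r2(1))
      qed
    qed
    then show ?thesis unfolding dec[of "l p"] by (simp add: sum_distrib_left)
  qed
  moreover have "(\<Sum>n=1..?d. if n < i then 1 - ?q n else if j \<le> n then ?q n else 0)
      = (\<Sum>n=1..?d. if n < i then 1 - ?q n else 0) + (\<Sum>n=1..?d. if j \<le> n then ?q n else 0)"
    unfolding sum.distrib[symmetric] by (rule sum.cong) (use i j in auto)
  ultimately show ?thesis by (simp add: L_def distrib_right)
qed

text \<open>The comparison matrix \<open>Q\<close> need not have trace \<open>p\<close>, so every
  comparison subtracts \<open>l p\<close> (or \<open>t p\<close>) times the trace. The perturbation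
  enters squared because the excess appears under a square root on the right and is
  absorbed.\<close>

lemma excess_perturbation_bound:
  fixes S T :: "real^'d^'d" and V :: "(real^'d) set"
  assumes S: "eigenframe S u l" and T: "eigenframe T v t"
    and V: "V \<in> subspaces_of_dim p" and p: "p \<in> {1..CARD('d) - 1}"
    and i: "i \<in> {1..p}" and j: "j \<in> {p+1..CARD('d)+1}"
    and max: "T \<bullet> proj_matrix V = (\<Sum>m=1..p. t m)"
    and r1: "0 \<le> r1" "1 < i \<Longrightarrow> 1 \<le> r1 * (l (i - 1) - l (p + 1))"
    and r2: "0 \<le> r2" "j \<le> CARD('d) \<Longrightarrow> 1 \<le> r2 * (l p - l j)"
  shows "(\<Sum>m=1..p. l m) - S \<bullet> proj_matrix V \<le>
    2 * real CARD('d) * (l i - l (j - 1)) +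
    (1 + 2 * (real CARD('d))\<^sup>2)\<^sup>2 * real CARD('d) * (norm (T - S))\<^sup>2 * (r1 + r2)"
proof -
  let ?d = "CARD('d)"
  let ?q = "\<lambda>m. u m \<bullet> (proj_matrix V *v u m)"
  define P where "P = proj_matrix V"
  define L where "L = (\<Sum>m=1..p. l m) - S \<bullet> P"
  define \<delta> where "\<delta> = (\<Sum>n=1..?d. if n < i then 1 - ?q n else if j \<le> n then ?q n else 0)"
  define \<eta> where "\<eta> = norm (T - S)"
  define c where "c = 1 + 2 * (real ?d)\<^sup>2"
  have o: "orthonormal_frame u" using S by (simp add: eigenframe_def)
  have ord: "l n \<le> l m" if "1 \<le> m" "m \<le> n" "n \<le> ?d" for m n
    using S that by (auto simp: eigenframe_def)
  have q: "0 \<le> ?q m" "?q m \<le> 1" if "m \<in> {1..?d}" for m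
    using proj_matrix_quadratic(1,2)[OF V, of "u m"] orthonormal_frame_inner[OF o that that]
    by auto
  have pd: "p \<le> ?d" "p \<in> {1..?d}" using p by auto
  have tr: "mat 1 \<bullet> P = real p" unfolding P_def by (rule trace_proj_matrix[OF V])
  have \<eta>: "0 \<le> \<eta>" and c: "1 \<le> c" by (simp_all add: \<eta>_def c_def)
  have L: "0 \<le> L" unfolding L_def P_def using ky_fan[OF S V] by simp
  have \<delta>L: "\<delta> \<le> (r1 + r2) * L"
    unfolding \<delta>_def L_def P_def by (rule excess_gap_bound[OF S V p i j r1 r2])
  obtain Q :: "real^'d^'d" where Q: "\<And>x. 0 \<le> x \<bullet> (Q *v x)" "\<And>x. x \<bullet> (Q *v x) \<le> x \<bullet> x"
    and Qm: "\<And>m. m \<in> {1..?d} \<Longrightarrow>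
      u m \<bullet> (Q *v u m) = (if m < i then 1 else if j \<le> m then 0 else ?q m)"
    and PQ: "norm (P - Q) \<le> sqrt (real ?d * \<delta>)"
    unfolding P_def \<delta>_def
    using block_compression[OF o V, of i j] i j by auto
  \<comment> \<open>\<open>P\<close> attains the relaxed Ky Fan bound of \<open>T\<close>, since it
    attains the Ky Fan sum and has trace \<open>p\<close>.\<close>
  have opt: "T \<bullet> (Q - P) - t p * (mat 1 \<bullet> (Q - P)) \<le> 0"
    using ky_fan_relaxed[OF T pd(2) Q] max tr by (simp add: P_def inner_diff_right algebra_simps)
  have tl: "\<bar>t p - l p\<bar> \<le> 2 * real ?d * \<eta>"
    unfolding \<eta>_def by (rule eigenvalue_lipschitz[OF T S pd(2)])
  \<comment> \<open>Exchanging \<open>S\<close> for \<open>T\<close> costs \<eta> times the distance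
    from \<open>P\<close> to \<open>Q\<close>; exchanging \<open>l p\<close> for \<open>t p\<close>
    costs \<open>2 * d * \<eta>\<close> times a trace of at most \<open>d\<close> times that
    distance, with \<open>d\<close> the dimension. Together they give the constant
    \<open>c\<close>.\<close>
  have "S \<bullet> (Q - P) - l p * (mat 1 \<bullet> (Q - P))
    = (T \<bullet> (Q - P) - t p * (mat 1 \<bullet> (Q - P))) + (T - S) \<bullet> (P - Q) + (t p - l p) * (mat 1 \<bullet> (Q - P))"
    by (simp add: inner_diff_left inner_diff_right algebra_simps)
  also have "\<dots> \<le> 0 + \<eta> * norm (P - Q) + (2 * real ?d * \<eta>) * (real ?d * norm (P - Q))"
  proof (intro add_mono opt)
    show "(T - S) \<bullet> (P - Q) \<le> \<eta> * norm (P - Q)" unfolding \<eta>_def by (rule norm_cauchy_schwarz)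
    have "\<bar>mat 1 \<bullet> (Q - P)\<bar> \<le> norm (mat 1 :: real^'d^'d) * norm (Q - P)"
      by (rule Cauchy_Schwarz_ineq2)
    also have "\<dots> \<le> real ?d * norm (P - Q)"
      by (simp add: norm_mat_1 mult_right_mono norm_minus_commute)
    finally have "\<bar>mat 1 \<bullet> (Q - P)\<bar> \<le> real ?d * norm (P - Q)" .
    then have "\<bar>t p - l p\<bar> * \<bar>mat 1 \<bullet> (Q - P)\<bar> \<le> (2 * real ?d * \<eta>) * (real ?d * norm (P - Q))"
      using tl \<eta> by (intro mult_mono) auto
    then show "(t p - l p) * (mat 1 \<bullet> (Q - P)) \<le> (2 * real ?d * \<eta>) * (real ?d * norm (P - Q))"
      by (metis abs_le_D1 abs_mult)
  qed
  also have "\<dots> = c * \<eta> * norm (P - Q)" by (simp add: c_def algebra_simps power2_eq_square)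
  also have "\<dots> \<le> c * \<eta> * sqrt (real ?d * \<delta>)"
    using PQ c \<eta> by (intro mult_left_mono) auto
  also have "\<dots> \<le> c * \<eta> * sqrt (real ?d * ((r1 + r2) * L))"
    using \<delta>L c \<eta> by (intro mult_left_mono real_sqrt_le_mono) auto
  also have "\<dots> = sqrt ((c\<^sup>2 * \<eta>\<^sup>2 * real ?d * (r1 + r2)) * L)"
    using c \<eta> by (simp add: real_sqrt_mult)
  also have "\<dots> \<le> (c\<^sup>2 * \<eta>\<^sup>2 * real ?d * (r1 + r2) + L) / 2"
    using L r1(1) r2(1) by (intro arith_geo_mean_sqrt) auto
  finally have 1: "S \<bullet> (Q - P) - l p * (mat 1 \<bullet> (Q - P)) \<le> (c\<^sup>2 * \<eta>\<^sup>2 * real ?d * (r1 + r2) + L) / 2" .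
  have "(\<Sum>m=1..p. l m) - real p * l p - (S \<bullet> Q - l p * (mat 1 \<bullet> Q))
    = (\<Sum>m=1..?d. (if m \<le> p then l m - l p else 0) - (l m - l p) * (u m \<bullet> (Q *v u m)))"
  proof -
    have "(\<Sum>m=1..?d. if m \<le> p then l m - l p else 0) = (\<Sum>m=1..p. l m - l p)"
      by (rule sum.mono_neutral_cong_right) (use p in auto)
    then show ?thesis
      unfolding eigenframe_inner[OF S] orthonormal_frame_trace[OF o]
      by (simp add: sum_distrib_left sum_subtractf left_diff_distrib)
  qed
  \<comment> \<open>Outside the block \<open>Q\<close> has the optimal weights 1 and 0, so those
    summands vanish; within it each is at most the spread of the block.\<close>
  also have "\<dots> \<le> (\<Sum>m=1..?d. l i - l (j - 1))"
  proof (rule sum_mono)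
    fix m assume m: "m \<in> {1..?d}"
    have lij: "l p \<le> l i" "l (j - 1) \<le> l p" using ord i j p by auto
    have "(l m - l p) * (1 - ?q m) \<le> l m - l p" if "m \<le> p"
      using mult_left_mono[of "1 - ?q m" 1 "l m - l p"] q[OF m] ord[of m p] m that pd by simp
    moreover have "(l p - l m) * ?q m \<le> l p - l m" if "p < m"
      using mult_left_mono[of "?q m" 1 "l p - l m"] q[OF m] ord[of p m] m that p by simp
    moreover have "l m \<le> l i" if "i \<le> m" using ord[of i m] that m i by auto
    moreover have "l (j - 1) \<le> l m" if "m < j" using ord[of m "j - 1"] that m j by auto
    ultimately show "(if m \<le> p then l m - l p else 0) - (l m - l p) * (u m \<bullet> (Q *v u m)) \<le> l i - l (j - 1)"
      unfolding Qm[OF m] using lij i j by (auto simp: algebra_simps)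
  qed
  finally have 2: "(\<Sum>m=1..p. l m) - real p * l p - (S \<bullet> Q - l p * (mat 1 \<bullet> Q)) \<le> real ?d * (l i - l (j - 1))"
    by simp
  have "L = ((\<Sum>m=1..p. l m) - real p * l p - (S \<bullet> Q - l p * (mat 1 \<bullet> Q)))
    + (S \<bullet> (Q - P) - l p * (mat 1 \<bullet> (Q - P)))"
    by (simp add: L_def inner_diff_right tr algebra_simps)
  \<comment> \<open>Absorption: half of the excess returns on the right-hand side, which doubles the
    other terms.\<close>
  moreover have "x + y \<le> 2 * A + B" if "y \<le> (B + (x + y)) / 2" "x \<le> A" for x y A B :: real
    using that by simp
  ultimately have "L \<le> 2 * (real ?d * (l i - l (j - 1))) + c\<^sup>2 * \<eta>\<^sup>2 * real ?d * (r1 + r2)"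
    using 1 2 by presburger
  then show ?thesis by (simp add: L_def P_def c_def \<eta>_def mult_ac)
qed

section \<open>The gap rate\<close>

text \<open>Separates the tie, whose reciprocal gap is infinite, from the finite case. The latter
  includes the conventional indices 0 and \<open>d + 1\<close> (\<open>d\<close> the dimension),
  where the reciprocal is 0.\<close>

lemma eigval_gap_reciprocal:
  fixes S :: "real^'d^'d"
  assumes S: "eigenframe S u l" and mn: "m \<le> n" "m \<le> CARD('d)" "1 \<le> n" "n \<le> CARD('d) + 1"
  defines "A \<equiv> eigval S m - eigval S n"
  obtains "1 / A = \<infinity>"
  | r where "1 / A = ereal r" "0 \<le> r" "1 \<le> m \<Longrightarrow> n \<le> CARD('d) \<Longrightarrow> 1 \<le> r * (l m - l n)"
proof (cases "1 \<le> m \<and> n \<le> CARD('d)")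
  case True
  then have A: "A = ereal (l m - l n)" and ge: "0 \<le> l m - l n"
    unfolding A_def using eigval_eigenframe[OF S] mn S by (auto simp: eigenframe_def)
  show ?thesis
  proof (cases "l m - l n = 0")
    case True
    then have "1 / A = \<infinity>" using A by (simp add: divide_ereal_def zero_ereal_def[symmetric])
    then show ?thesis by (rule that(1))
  next
    case False
    then have "1 / A = ereal (1 / (l m - l n))" using A by (simp add: one_ereal_def)
    then show ?thesis by (rule that(2)) (use False ge in auto)
  qed
next
  case False
  have "eigval S m = \<infinity> \<or> (\<exists>x. eigval S m = ereal x)" "eigval S n = - \<infinity> \<or> (\<exists>x. eigval S n = ereal x)"
    using mn by (auto simp: eigval_def)
  \<comment> \<open>The conventional values enter the difference with signs that cannot cancel, so
    it is plus infinity.\<close>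
  moreover have "eigval S m = \<infinity> \<or> eigval S n = - \<infinity>" using False mn by (auto simp: eigval_def)
  ultimately have "A = \<infinity>" unfolding A_def by auto
  then have "1 / A = ereal 0" by simp
  then show ?thesis by (rule that(2)) (use False in auto)
qed

lemma gap_rate_entry:
  fixes S :: "real^'d^'d"
  assumes "p \<in> {1..CARD('d) - 1}"
  obtains i j where "i \<in> {1..p}" "j \<in> {p+1..CARD('d)+1}"
    "gap_rate S k p = ereal (1 / real k) *
          (1 / (eigval S (i - 1) - eigval S (p + 1)) + 1 / (eigval S p - eigval S j))
        + (eigval S i - eigval S (j - 1))"
proof -
  let ?f = "\<lambda>(i, j). ereal (1 / real k) *
          (1 / (eigval S (i - 1) - eigval S (p + 1)) + 1 / (eigval S p - eigval S j))
        + (eigval S i - eigval S (j - 1))"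
  have "gap_rate S k p \<in> ?f ` ({1..p} \<times> {p+1..CARD('d)+1})"
    unfolding gap_rate_def by (rule Min_in) (use assms in auto)
  then show ?thesis using that by auto
qed

text \<open>The perturbation bound is applied to a pair attaining the minimum. \<open>C\<close>
  depends only on the dimension and on \<open>K\<close>, hence can serve all sample sizes at
  once.\<close>

lemma excess_le_gap_rate:
  fixes S T :: "real^'d^'d"
  assumes S: "eigenframe S u l" and T: "eigenframe T v t"
    and V: "V \<in> subspaces_of_dim p" and p: "p \<in> {1..CARD('d) - 1}" and k: "0 < k"
    and max: "T \<bullet> proj_matrix V = (\<Sum>m=1..p. t m)"
    and TS: "(norm (T - S))\<^sup>2 \<le> K / real k"
    and C: "2 * real CARD('d) \<le> C" "(1 + 2 * (real CARD('d))\<^sup>2)\<^sup>2 * real CARD('d) * K \<le> C"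
  shows "ereal (excess_risk S p V) \<le> ereal C * gap_rate S k p"
proof -
  let ?d = "CARD('d)"
  obtain i j where i: "i \<in> {1..p}" and j: "j \<in> {p+1..?d+1}"
    and gr: "gap_rate S k p = ereal (1 / real k) *
          (1 / (eigval S (i - 1) - eigval S (p + 1)) + 1 / (eigval S p - eigval S j))
        + (eigval S i - eigval S (j - 1))"
    using gap_rate_entry[OF p, where S=S and k=k] by metis
  have Cpos: "0 < C" using C(1) by (rule less_le_trans[rotated]) simp
  have ij: "1 \<le> i" "i \<le> CARD('d)" "1 \<le> j - 1" "j - 1 \<le> CARD('d)" using i j p by auto
  have e: "eigval S i - eigval S (j - 1) = ereal (l i - l (j - 1))"
    using eigval_eigenframe[OF S, of i] eigval_eigenframe[OF S, of "j - 1"] ij by simp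
  have lij: "0 \<le> l i - l (j - 1)"
  proof -
    have "i \<le> j - 1" using i j by auto
    then show ?thesis using S ij by (auto simp: eigenframe_def)
  qed
  let ?A = "1 / (eigval S (i - 1) - eigval S (p + 1))" and ?B = "1 / (eigval S p - eigval S j)"
  have A: "?A = \<infinity> \<or> (\<exists>r. ?A = ereal r \<and> 0 \<le> r \<and> (1 < i \<longrightarrow> 1 \<le> r * (l (i - 1) - l (p + 1))))"
    by (rule eigval_gap_reciprocal[OF S, of "i - 1" "p + 1"]) (use i p in auto)
  have B: "?B = \<infinity> \<or> (\<exists>r. ?B = ereal r \<and> 0 \<le> r \<and> (j \<le> ?d \<longrightarrow> 1 \<le> r * (l p - l j)))"
    by (rule eigval_gap_reciprocal[OF S, of p j]) (use j p in auto)
  show ?thesis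
  proof (cases "?A = \<infinity> \<or> ?B = \<infinity>")
    \<comment> \<open>A vanishing gap makes the rate infinite, since neither reciprocal is minus
      infinity and \<open>1 / k\<close> is positive.\<close>
    case True
    then have "?A + ?B = \<infinity>" using A B by auto
    then have "gap_rate S k p = \<infinity>" unfolding gr e using k by simp
    then show ?thesis using Cpos by simp
  next
    case False
    then obtain r1 r2 where r1: "?A = ereal r1" "0 \<le> r1" "1 < i \<Longrightarrow> 1 \<le> r1 * (l (i - 1) - l (p + 1))"
      and r2: "?B = ereal r2" "0 \<le> r2" "j \<le> ?d \<Longrightarrow> 1 \<le> r2 * (l p - l j)"
      using A B by blast
    have "excess_risk S p V \<le> 2 * real ?d * (l i - l (j - 1)) +
      (1 + 2 * (real ?d)\<^sup>2)\<^sup>2 * real ?d * (norm (T - S))\<^sup>2 * (r1 + r2)"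
      unfolding excess_risk_eq[OF S V]
      by (rule excess_perturbation_bound[OF S T V p i j max r1(2,3) r2(2,3)])
    also have "\<dots> \<le> C * (l i - l (j - 1)) + C * (1 / real k * (r1 + r2))"
    proof (rule add_mono)
      show "2 * real ?d * (l i - l (j - 1)) \<le> C * (l i - l (j - 1))"
        by (rule mult_right_mono[OF C(1) lij])
      have "(1 + 2 * (real ?d)\<^sup>2)\<^sup>2 * real ?d * (norm (T - S))\<^sup>2
        \<le> (1 + 2 * (real ?d)\<^sup>2)\<^sup>2 * real ?d * (K / real k)"
        by (rule mult_left_mono[OF TS]) simp
      also have "\<dots> \<le> C / real k" using C(2) k by (simp add: divide_right_mono)
      finally have "(1 + 2 * (real ?d)\<^sup>2)\<^sup>2 * real ?d * (norm (T - S))\<^sup>2 * (r1 + r2) \<le> C / real k * (r1 + r2)"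
        by (rule mult_right_mono) (use r1 r2 in simp)
      then show "(1 + 2 * (real ?d)\<^sup>2)\<^sup>2 * real ?d * (norm (T - S))\<^sup>2 * (r1 + r2) \<le> C * (1 / real k * (r1 + r2))"
        by simp
    qed
    also have "\<dots> = C * (1 / real k * (r1 + r2) + (l i - l (j - 1)))" by (simp add: algebra_simps)
    finally show ?thesis unfolding gr e r1(1) r2(1) by simp
  qed
qed

text \<open>Every admissible pair bounds the minimum. The conditions on gaps become vacuous when the
  neighbouring index is a conventional one.\<close>

lemma gap_rate_le:
  fixes S :: "real^'d^'d"
  assumes S: "eigenframe S u l" and p: "p \<in> {1..CARD('d) - 1}"
    and i: "i \<in> {1..p}" and j: "j \<in> {p+1..CARD('d)+1}"
    and r1: "0 \<le> r1" "1 < i \<Longrightarrow> 0 < l (i - 1) - l (p + 1) \<and> 1 / (l (i - 1) - l (p + 1)) \<le> r1"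
    and r2: "0 \<le> r2" "j \<le> CARD('d) \<Longrightarrow> 0 < l p - l j \<and> 1 / (l p - l j) \<le> r2"
  shows "gap_rate S k p \<le> ereal (1 / real k * (r1 + r2) + (l i - l (j - 1)))"
proof -
  let ?A = "1 / (eigval S (i - 1) - eigval S (p + 1))" and ?B = "1 / (eigval S p - eigval S j)"
  have ev: "eigval S m = ereal (l m)" if "1 \<le> m" "m \<le> CARD('d)" for m
    using eigval_eigenframe[OF S] that by simp
  have A: "?A \<le> ereal r1"
  proof (cases "1 < i")
    case True
    then have "?A = ereal (1 / (l (i - 1) - l (p + 1)))"
      using r1(2) ev[of "i - 1"] ev[of "p + 1"] i p by (auto simp: one_ereal_def)
    then show ?thesis using r1(2)[OF True] by simp
  next
    case False
    then have "eigval S (i - 1) = \<infinity>" using i by (simp add: eigval_def)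
    then show ?thesis using r1(1) ev[of "p + 1"] p by simp
  qed
  have B: "?B \<le> ereal r2"
  proof (cases "j \<le> CARD('d)")
    case True
    then have "?B = ereal (1 / (l p - l j))"
      using r2(2) ev[of p] ev[of j] j p by (auto simp: one_ereal_def)
    then show ?thesis using r2(2)[OF True] by simp
  next
    case False
    then have "eigval S j = - \<infinity>" using j by (simp add: eigval_def)
    then show ?thesis using r2(1) ev[of p] p by simp
  qed
  have ij: "1 \<le> i" "i \<le> CARD('d)" "1 \<le> j - 1" "j - 1 \<le> CARD('d)" using i j p by auto
  have e: "eigval S i - eigval S (j - 1) = ereal (l i - l (j - 1))"
    using ev[of i] ev[of "j - 1"] ij by simp
  have "gap_rate S k p \<le> ereal (1 / real k) * (?A + ?B) + (eigval S i - eigval S (j - 1))"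
    unfolding gap_rate_def by (rule Min_le) (use i j in auto)
  also have "\<dots> \<le> ereal (1 / real k) * (ereal r1 + ereal r2) + ereal (l i - l (j - 1))"
    unfolding e by (intro add_mono ereal_mult_left_mono A B) auto
  finally show ?thesis by simp
qed

text \<open>Take the cluster of eigenvalues within \<open>s\<close> of \<open>l p\<close>. The gaps
  around it exceed \<open>s\<close>, and \<open>1 / k\<close> is the square of \<open>s\<close>, so
  the reciprocals contribute \<open>2 * s\<close>; the cluster is at most \<open>2 * s\<close>
  wide.\<close>

lemma gap_rate_le_sqrt:
  fixes S :: "real^'d^'d"
  assumes S: "eigenframe S u l" and p: "p \<in> {1..CARD('d) - 1}" and k: "0 < k"
  shows "gap_rate S k p \<le> ereal (4 * real k powr (-1/2))"
proof -
  let ?d = "CARD('d)"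
  have pd: "1 \<le> p" "p + 1 \<le> ?d" using p by auto
  define s where "s = real k powr (-1/2)"
  have s: "0 < s" using k by (simp add: s_def)
  have ss: "1 / real k = s * s" using k by (simp add: s_def powr_add[symmetric] powr_minus_divide)
  have ord: "l n \<le> l m" if "1 \<le> m" "m \<le> n" "n \<le> ?d" for m n
    using S that by (auto simp: eigenframe_def)
  define i where "i = (LEAST i. 1 \<le> i \<and> l i - l p \<le> s)"
  have i: "1 \<le> i" "l i - l p \<le> s" "i \<le> p"
    unfolding i_def using LeastI[of "\<lambda>i. 1 \<le> i \<and> l i - l p \<le> s" p]
      Least_le[of "\<lambda>i. 1 \<le> i \<and> l i - l p \<le> s" p] p s by auto
  have i': "s < l (i - 1) - l p" if "1 < i"
    using not_less_Least[of "i - 1" "\<lambda>i. 1 \<le> i \<and> l i - l p \<le> s", folded i_def] that by auto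
  \<comment> \<open>The alternative \<open>?d < j\<close> makes the least element exist: if no later
    eigenvalue is far from \<open>l p\<close>, then \<open>j\<close> is one past the
    dimension.\<close>
  define R where "R = (\<lambda>j. p + 1 \<le> j \<and> (?d < j \<or> s < l p - l j))"
  define j where "j = (LEAST j. R j)"
  have "R (?d + 1)" using p by (auto simp: R_def)
  then have j: "R j" "j \<le> ?d + 1" unfolding j_def by (auto intro: LeastI Least_le)
  \<comment> \<open>Either \<open>j - 1\<close> is \<open>p\<close> itself, or it lies beyond
    \<open>p\<close> and violates \<open>R\<close> by minimality of \<open>j\<close>.\<close>
  have j': "l p - l (j - 1) \<le> s"
  proof (cases "j - 1 = p")
    case False
    have "\<not> R (j - 1)" using j(1) by (intro not_less_Least[of "j - 1" R, folded j_def]) (auto simp: R_def)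
    then show ?thesis using False j by (auto simp: R_def)
  qed (use s in simp)
  have "gap_rate S k p \<le> ereal (1 / real k * (1 / s + 1 / s) + (l i - l (j - 1)))"
  proof (rule gap_rate_le[OF S p])
    show "i \<in> {1..p}" "j \<in> {p+1..?d+1}" using i j by (auto simp: R_def)
    show "0 < l (i - 1) - l (p + 1) \<and> 1 / (l (i - 1) - l (p + 1)) \<le> 1 / s" if "1 < i"
    proof -
      have "s < l (i - 1) - l (p + 1)" using i'[OF that] ord[of p "p + 1"] pd by auto
      then show ?thesis using s by (auto intro!: divide_left_mono)
    qed
    show "0 < l p - l j \<and> 1 / (l p - l j) \<le> 1 / s" if "j \<le> ?d"
    proof -
      have "s < l p - l j" using j(1) that by (auto simp: R_def)
      then show ?thesis using s by (auto intro!: divide_left_mono)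
    qed
  qed (use s in auto)
  also have "\<dots> \<le> ereal (4 * s)"
    using s i(2) j' unfolding ss by (simp add: field_simps)
  finally show ?thesis by (simp add: s_def)
qed

text \<open>Two bounds are available: the cluster bound of order \<open>s\<close>, and the bound
  from the block with its width \<open>G\<close> and gaps of at least \<open>g\<close>. The smaller
  of \<open>s\<close> and \<open>G\<close> decides which one is used.\<close>

lemma gap_rate_le_block_rate:
  fixes S :: "real^'d^'d"
  assumes S: "eigenframe S u l" and p: "p \<in> {1..CARD('d) - 1}" and k: "0 < k"
    and N: "N0 < p" "p \<le> N1" "N1 \<le> CARD('d)" and g: "0 < g"
    and g0: "1 \<le> N0 \<Longrightarrow> g \<le> l N0 - l p" and g1: "N1 < CARD('d) \<Longrightarrow> g \<le> l p - l (N1 + 1)"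
  shows "gap_rate S k p \<le> ereal (max 4 (2 / g)) * (ereal (1 / real k) +
    min (ereal (real k powr (-1/2))) (eigval S (N0 + 1) - eigval S N1))"
proof -
  let ?d = "CARD('d)"
  have pd: "1 \<le> p" "p + 1 \<le> ?d" using p by auto
  define s where "s = real k powr (-1/2)"
  define G where "G = l (N0 + 1) - l N1"
  define C where "C = max 4 (2 / g)"
  have s: "0 < s" using k by (simp add: s_def)
  have C: "4 \<le> C" "2 / g \<le> C" by (auto simp: C_def)
  have ord: "l n \<le> l m" if "1 \<le> m" "m \<le> n" "n \<le> ?d" for m n
    using S that by (auto simp: eigenframe_def)
  have G: "0 \<le> G" unfolding G_def using ord N p by auto
  have e: "eigval S (N0 + 1) - eigval S N1 = ereal G"
    unfolding G_def using eigval_eigenframe[OF S] N p by simp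
  have 1: "gap_rate S k p \<le> ereal (4 * s)" unfolding s_def by (rule gap_rate_le_sqrt[OF S p k])
  \<comment> \<open>The pair is \<open>(N0 + 1, N1 + 1)\<close>: the rate looks at
    \<open>i - 1\<close> and \<open>j\<close>, the neighbours of the block, for gaps and at
    \<open>i\<close> and \<open>j - 1\<close>, its ends, for the width.\<close>
  have 2: "gap_rate S k p \<le> ereal (1 / real k * (1 / g + 1 / g) + (l (N0 + 1) - l (N1 + 1 - 1)))"
  proof (rule gap_rate_le[OF S p])
    show "0 < l (N0 + 1 - 1) - l (p + 1) \<and> 1 / (l (N0 + 1 - 1) - l (p + 1)) \<le> 1 / g" if "1 < N0 + 1"
    proof -
      have "g \<le> l N0 - l (p + 1)" using g0 that ord[of p "p + 1"] pd by auto
      then show ?thesis using g by (auto intro!: divide_left_mono)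
    qed
    show "0 < l p - l (N1 + 1) \<and> 1 / (l p - l (N1 + 1)) \<le> 1 / g" if "N1 + 1 \<le> ?d"
    proof -
      have "g \<le> l p - l (N1 + 1)" using g1 that by auto
      then show ?thesis using g by (auto intro!: divide_left_mono)
    qed
  qed (use N g in auto)
  have "gap_rate S k p \<le> ereal (C * (1 / real k + min s G))"
  proof (cases "s \<le> G")
    case True
    have "4 * s \<le> C * s" using C s by (simp add: mult_right_mono)
    also have "\<dots> \<le> C * (1 / real k + min s G)" using True C by (intro mult_left_mono) auto
    finally show ?thesis using 1 by (meson ereal_less_eq(3) order_trans)
  next
    case False
    have "1 / real k * (1 / g + 1 / g) + G \<le> C * (1 / real k) + C * G"
    proof (rule add_mono)
      have "1 / real k * (2 / g) \<le> 1 / real k * C" using C by (intro mult_left_mono) auto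
      then show "1 / real k * (1 / g + 1 / g) \<le> C * (1 / real k)" by (simp add: mult.commute)
      show "G \<le> C * G" using C G mult_right_mono[of 1 C G] by simp
    qed
    also have "\<dots> = C * (1 / real k + min s G)" using False by (simp add: distrib_left)
    finally have "1 / real k * (1 / g + 1 / g) + (l (N0 + 1) - l (N1 + 1 - 1)) \<le> C * (1 / real k + min s G)"
      by (simp add: G_def)
    then show ?thesis using 2 by (meson ereal_less_eq(3) order_trans)
  qed
  moreover have "ereal (min s G) = min (ereal s) (ereal G)" by (simp add: min_def)
  ultimately show ?thesis
    unfolding e C_def[symmetric] s_def[symmetric] by (metis plus_ereal.simps(1) times_ereal.simps(1))
qed

text \<open>Enlarging a rate up to a constant shrinks the exceptional event, and the constants
  multiply. This is what compares the two rates of the theorem.\<close>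

lemma bigO_prob_mono:
  assumes a: "bigO_prob M Z a" and C: "0 < C" and le: "\<forall>\<^sub>F n in sequentially. a n \<le> ereal C * b n"
  shows "bigO_prob M Z b"
  unfolding bigO_prob_def
proof (intro allI impI)
  fix \<epsilon> :: real assume "\<epsilon> > 0"
  then obtain K where K: "K > 0" "\<forall>\<^sub>F n in sequentially.
      outer_measure_of M {w \<in> space M. ereal K * a n < ereal \<bar>Z n w\<bar>} \<le> ennreal \<epsilon>"
    using a unfolding bigO_prob_def by blast
  have "\<forall>\<^sub>F n in sequentially.
      outer_measure_of M {w \<in> space M. ereal (K * C) * b n < ereal \<bar>Z n w\<bar>} \<le> ennreal \<epsilon>"
    using K(2) le
  proof eventually_elim
    case (elim n)
    have "ereal K * a n \<le> ereal K * (ereal C * b n)"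
      using elim(2) K(1) by (intro ereal_mult_left_mono) auto
    then have *: "ereal K * a n \<le> ereal (K * C) * b n" by (simp add: mult.assoc[symmetric])
    have "outer_measure_of M {w \<in> space M. ereal (K * C) * b n < ereal \<bar>Z n w\<bar>}
      \<le> outer_measure_of M {w \<in> space M. ereal K * a n < ereal \<bar>Z n w\<bar>}"
      by (rule outer_measure_of_mono) (use * in \<open>auto intro: le_less_trans\<close>)
    then show ?case using elim(1) by (rule order_trans)
  qed
  then show "\<exists>C>0. \<forall>\<^sub>F n in sequentially.
      outer_measure_of M {w \<in> space M. ereal C * b n < ereal \<bar>Z n w\<bar>} \<le> ennreal \<epsilon>"
    using K(1) C by (intro exI[of _ "K * C"]) auto
qed

section \<open>Sums of independent bounded variables\<close>

context prob_space
begin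

lemma bounded_integrable:
  fixes f :: "'a \<Rightarrow> 'b::{banach, second_countable_topology}"
  assumes "f \<in> borel_measurable M" "\<And>w. w \<in> space M \<Longrightarrow> norm (f w) \<le> B"
  shows "integrable M f"
  by (rule integrable_const_bound[of _ B]) (use assms in auto)

lemma bounded_square_integrable:
  fixes f :: "'a \<Rightarrow> real"
  assumes "f \<in> borel_measurable M" "\<And>w. w \<in> space M \<Longrightarrow> \<bar>f w\<bar> \<le> B"
  shows "integrable M (\<lambda>w. (f w)\<^sup>2)"
proof (rule bounded_integrable)
  show "norm ((f w)\<^sup>2) \<le> B\<^sup>2" if "w \<in> space M" for w
    using power_mono[OF assms(2)[OF that], of 2] by simp
qed (use assms(1) in simp)

text \<open>Independence and centering make the cross term vanish when a summand is added.\<close>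

lemma second_moment_indep_sum:
  fixes W :: "nat \<Rightarrow> 'a \<Rightarrow> real"
  assumes "finite I" "indep_vars (\<lambda>_. borel) W I"
    "\<And>i w. i \<in> I \<Longrightarrow> w \<in> space M \<Longrightarrow> \<bar>W i w\<bar> \<le> b" "\<And>i. i \<in> I \<Longrightarrow> expectation (W i) = 0"
  shows "expectation (\<lambda>w. (\<Sum>i\<in>I. W i w)\<^sup>2) = (\<Sum>i\<in>I. expectation (\<lambda>w. (W i w)\<^sup>2))"
  using assms
proof (induction I rule: finite_induct)
  case empty
  then show ?case by simp
next
  case (insert i I)
  let ?S = "\<lambda>w. \<Sum>j\<in>I. W j w"
  have meas: "W j \<in> borel_measurable M" if "j \<in> insert i I" for j
    using insert.prems(1) that unfolding indep_vars_def2 by blast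
  have int: "integrable M (W j)" if "j \<in> insert i I" for j
    by (rule bounded_integrable[OF meas[OF that], of b]) (use insert.prems(2) that in auto)
  have Sm: "?S \<in> borel_measurable M" by (rule borel_measurable_sum) (use meas in auto)
  have Sb: "\<bar>?S w\<bar> \<le> real (card I) * b" if "w \<in> space M" for w
    by (rule order_trans[OF sum_abs]) (rule sum_bounded_above, use insert.prems(2) that in auto)
  have Si: "integrable M ?S" by (rule Bochner_Integration.integrable_sum) (use int in auto)
  have sq: "integrable M (\<lambda>w. (f w)\<^sup>2)"
    if "f \<in> borel_measurable M" "\<And>w. w \<in> space M \<Longrightarrow> \<bar>f w\<bar> \<le> c" for f :: "'a \<Rightarrow> real" and c
    by (rule bounded_square_integrable[OF that])
  have ind: "indep_var borel (W i) borel ?S"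
    by (rule indep_vars_sum[OF insert.hyps insert.prems(1)])
  note prod = indep_var_lebesgue_integral[OF ind int[of i] Si] indep_var_integrable[OF ind int[of i] Si]
  have "expectation (\<lambda>w. (\<Sum>j\<in>insert i I. W j w)\<^sup>2)
      = expectation (\<lambda>w. (W i w)\<^sup>2 + 2 * (W i w * ?S w) + (?S w)\<^sup>2)"
    using insert.hyps by (simp add: power2_sum algebra_simps)
  also have "\<dots> = expectation (\<lambda>w. (W i w)\<^sup>2) + 2 * expectation (\<lambda>w. W i w * ?S w) + expectation (\<lambda>w. (?S w)\<^sup>2)"
  proof -
    have 1: "integrable M (\<lambda>w. (W i w)\<^sup>2)" by (rule sq[of _ b]) (use meas insert.prems(2) in auto)
    have 2: "integrable M (\<lambda>w. (?S w)\<^sup>2)" by (rule sq[OF Sm Sb])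
    show ?thesis using 1 2 prod(2) by simp
  qed
  also have "expectation (\<lambda>w. W i w * ?S w) = 0" using prod(1) insert.prems(3)[of i] by simp
  also have "expectation (\<lambda>w. (?S w)\<^sup>2) = (\<Sum>j\<in>I. expectation (\<lambda>w. (W j w)\<^sup>2))"
    by (rule insert.IH) (use insert.prems in \<open>auto intro: indep_vars_subset\<close>)
  finally show ?case using insert.hyps by simp
qed

text \<open>Chebyshev with the variance of each summand bounded by its raw second moment. The
  uniform bound \<open>b\<close> gives integrability; the size is carried by \<open>v\<close>, which
  for rare exceedances is much smaller than the square of \<open>b\<close>.\<close>

lemma indep_sum_deviation:
  fixes Y :: "nat \<Rightarrow> 'a \<Rightarrow> real"
  assumes Y: "finite I" "indep_vars (\<lambda>_. borel) Y I"
    and b: "\<And>i w. i \<in> I \<Longrightarrow> w \<in> space M \<Longrightarrow> \<bar>Y i w\<bar> \<le> b"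
    and m: "\<And>i. i \<in> I \<Longrightarrow> expectation (Y i) = m"
    and v: "\<And>i. i \<in> I \<Longrightarrow> expectation (\<lambda>w. (Y i w)\<^sup>2) \<le> v"
    and c: "0 < c"
  shows "prob {w \<in> space M. c \<le> \<bar>(\<Sum>i\<in>I. Y i w) - real (card I) * m\<bar>} \<le> real (card I) * v / c\<^sup>2"
proof -
  have meas: "Y i \<in> borel_measurable M" if "i \<in> I" for i
    using Y(2) that unfolding indep_vars_def2 by blast
  have int: "integrable M (Y i)" if "i \<in> I" for i
    by (rule bounded_integrable[OF meas[OF that], of b]) (use b that in auto)
  have int2: "integrable M (\<lambda>w. (Y i w)\<^sup>2)" if "i \<in> I" for i
    by (rule bounded_square_integrable[OF meas[OF that] b[OF that]])
  let ?W = "\<lambda>i w. Y i w - m"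
  let ?S = "\<lambda>w. \<Sum>i\<in>I. Y i w"
  have Sm: "?S \<in> borel_measurable M" by (rule borel_measurable_sum) (use meas in auto)
  have Sb: "\<bar>?S w\<bar> \<le> real (card I) * b" if "w \<in> space M" for w
    by (rule order_trans[OF sum_abs]) (rule sum_bounded_above, use b that in auto)
  have S2: "integrable M (\<lambda>w. (?S w)\<^sup>2)"
    by (rule bounded_square_integrable[OF Sm Sb])
  have ES: "expectation ?S = real (card I) * m" using int m by simp
  have "variance ?S = expectation (\<lambda>w. (\<Sum>i\<in>I. ?W i w)\<^sup>2)" unfolding ES by (simp add: sum_subtractf)
  also have "\<dots> = (\<Sum>i\<in>I. expectation (\<lambda>w. (?W i w)\<^sup>2))"
  proof (rule second_moment_indep_sum[OF Y(1), of _ "b + \<bar>m\<bar>"])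
    show "indep_vars (\<lambda>_. borel) ?W I"
      by (rule indep_vars_compose2[OF Y(2), of "\<lambda>_ y. y - m"]) auto
    show "\<bar>?W i w\<bar> \<le> b + \<bar>m\<bar>" if "i \<in> I" "w \<in> space M" for i w
      using b[OF that] by linarith
    show "expectation (?W i) = 0" if "i \<in> I" for i
      using int[OF that] m[OF that] by (simp add: prob_space)
  qed
  also have "\<dots> \<le> (\<Sum>i\<in>I. v)"
  proof (rule sum_mono)
    fix i assume i: "i \<in> I"
    have "expectation (\<lambda>w. (?W i w)\<^sup>2) = expectation (\<lambda>w. (Y i w)\<^sup>2) - m\<^sup>2"
      using variance_eq[OF int[OF i] int2[OF i]] m[OF i] by simp
    then show "expectation (\<lambda>w. (?W i w)\<^sup>2) \<le> v" using v[OF i] by (smt (verit) zero_le_power2)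
  qed
  finally have "variance ?S \<le> real (card I) * v" by simp
  then have "variance ?S / c\<^sup>2 \<le> real (card I) * v / c\<^sup>2" by (rule divide_right_mono) simp
  then show ?thesis using Chebyshev_inequality[OF Sm S2 c] unfolding ES by linarith
qed

text \<open>By Fubini the diagonal has product measure 0, because its sections are single points and
  the law of \<open>A\<close> has no atoms.\<close>

lemma AE_indep_neq:
  fixes A B :: "'a \<Rightarrow> real"
  assumes ind: "indep_var borel A borel B" and atom: "\<And>x. measure (distr M borel A) {x} = 0"
  shows "AE w in M. A w \<noteq> B w"
proof -
  have [measurable]: "A \<in> borel_measurable M" "B \<in> borel_measurable M"
    using ind indep_var_rv1 indep_var_rv2 by blast+
  interpret A: prob_space "distr M borel A" by (rule prob_space_distr) simp
  interpret B: prob_space "distr M borel B" by (rule prob_space_distr) simp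
  interpret AB: pair_prob_space "distr M borel A" "distr M borel B" ..
  have eq: "distr M borel A \<Otimes>\<^sub>M distr M borel B = distr M (borel \<Otimes>\<^sub>M borel) (\<lambda>x. (A x, B x))"
    using ind by (simp add: indep_var_distribution_eq)
  let ?D = "{p :: real \<times> real. fst p = snd p}"
  have D: "?D \<in> sets (borel \<Otimes>\<^sub>M borel)" 
  proof -
    have "{p \<in> space (borel \<Otimes>\<^sub>M borel). fst p = (snd p :: real)} \<in> sets (borel \<Otimes>\<^sub>M borel)" by measurable
    then show ?thesis by (simp add: space_pair_measure)
  qed
  have "emeasure (distr M borel A \<Otimes>\<^sub>M distr M borel B) ?D
      = (\<integral>\<^sup>+y. emeasure (distr M borel A) ((\<lambda>x. (x, y)) -` ?D) \<partial>distr M borel B)"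
    by (rule AB.emeasure_pair_measure_alt2) (use D in simp)
  also have "\<dots> = (\<integral>\<^sup>+y. 0 \<partial>distr M borel B)"
  proof (rule nn_integral_cong)
    fix y
    have "(\<lambda>x. (x, y)) -` ?D = {y}" by auto
    then show "emeasure (distr M borel A) ((\<lambda>x. (x, y)) -` ?D) = 0"
      using atom[of y] by (simp add: A.emeasure_eq_measure)
  qed
  finally have "emeasure (distr M (borel \<Otimes>\<^sub>M borel) (\<lambda>x. (A x, B x))) ?D = 0"
    unfolding eq by simp
  then have "emeasure M ((\<lambda>x. (A x, B x)) -` ?D \<inter> space M) = 0"
    using D by (subst (asm) emeasure_distr) auto
  then show ?thesis
    by (intro AE_I[of _ _ "(\<lambda>x. (A x, B x)) -` ?D \<inter> space M"]) (auto intro!: measurable_sets[OF _ D])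
qed

section \<open>Quantiles of a continuous distribution\<close>

text \<open>Continuity makes the superlevel set of the distribution function closed, so the infimum
  belongs to it; the intermediate value theorem excludes a larger value there.\<close>

lemma cdf_quantile:
  fixes R :: "'a \<Rightarrow> real"
  assumes [measurable]: "R \<in> borel_measurable M"
    and cont: "continuous_on UNIV (cdf (distr M borel R))" and q: "0 < q" "q < 1"
  shows "cdf (distr M borel R) (quantile M R q) = q"
    and "\<And>y. cdf (distr M borel R) y < q \<Longrightarrow> y \<le> quantile M R q"
proof -
  interpret R: real_distribution "distr M borel R"
    by (intro real_distribution.intro prob_space_distr) (auto simp: real_distribution_axioms_def)
  let ?F = "cdf (distr M borel R)"
  let ?A = "{x. q \<le> ?F x}"
  have lower: "y < x" if "?F y < q" "x \<in> ?A" for x y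
  proof (rule ccontr)
    assume "\<not> y < x"
    then have "?F x \<le> ?F y" by (intro R.cdf_nondecreasing) simp
    then show False using that by simp
  qed
  have "\<forall>\<^sub>F x in at_top. q < ?F x" by (rule order_tendstoD(1)[OF R.cdf_lim_at_top_prob q(2)])
  then have ne: "?A \<noteq> {}" 
    by (metis (mono_tags, lifting) empty_iff eventually_at_top_linorder less_eq_real_def mem_Collect_eq order_refl)
  have "\<forall>\<^sub>F x in at_bot. ?F x < q" by (rule order_tendstoD(2)[OF R.cdf_lim_at_bot q(1)])
  then obtain y0 where y0: "?F y0 < q" by (auto simp: eventually_at_bot_linorder)
  have bdd: "bdd_below ?A" by (rule bdd_belowI[of _ y0]) (use lower[OF y0] in force)
  show below: "\<And>y. ?F y < q \<Longrightarrow> y \<le> quantile M R q"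
    unfolding quantile_def by (rule cInf_greatest[OF ne]) (use lower in force)
  have "closed ?A" by (rule closed_Collect_le) (use cont in auto)
  then have "Inf ?A \<in> ?A" using closed_contains_Inf[OF ne bdd] by blast
  then have ge: "q \<le> ?F (quantile M R q)" by (simp add: quantile_def)
  moreover have "?F (quantile M R q) \<le> q"
  proof (rule ccontr)
    assume less: "\<not> ?thesis"
    \<comment> \<open>A point at or below the quantile with value exactly \<open>q\<close> belongs
      to the set of which the quantile is the infimum, so it must be the quantile.\<close>
    obtain x where x: "x \<le> quantile M R q" "y0 \<le> x" "?F x = q"
    proof -
      have "\<exists>x. y0 \<le> x \<and> x \<le> quantile M R q \<and> ?F x = q"
        by (rule IVT') (use y0 ge below[OF y0] cont in \<open>auto intro: continuous_on_subset\<close>)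
      then show ?thesis using that by blast
    qed
    then have "quantile M R q \<le> x"
      unfolding quantile_def by (intro cInf_lower[OF _ bdd]) auto
    then show False using x less by simp
  qed
  ultimately show "?F (quantile M R q) = q" by simp
qed

end

section \<open>Order statistics\<close>

text \<open>List positions start at 0, so position \<open>k\<close> of the decreasing list is the
  \<open>k + 1\<close>-st largest entry. Without ties the larger entries are precisely those at
  earlier positions.\<close>

lemma card_greater_rev_sort_nth:
  fixes xs :: "'a::linorder list"
  assumes dist: "distinct xs" and k: "k < length xs"
  shows "card {x \<in> set xs. rev (sort xs) ! k < x} = k"
proof -
  let ?ys = "rev (sort xs)"
  have dys: "distinct ?ys" and len: "length ?ys = length xs" and set: "set ?ys = set xs"
    using dist by auto
  have mono: "?ys ! j \<le> ?ys ! i" if "i \<le> j" "j < length xs" for i j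
    using that sorted_rev_nth_mono[of ?ys i j] by simp
  have "{x \<in> set xs. ?ys ! k < x} = (!) ?ys ` {..<k}"
  proof (intro equalityI subsetI)
    fix x assume x: "x \<in> {x \<in> set xs. ?ys ! k < x}"
    then obtain i where i: "i < length xs" "x = ?ys ! i"
      using set len by (metis (no_types, lifting) in_set_conv_nth mem_Collect_eq)
    then have "i < k" using mono[of k i] x by (cases "i < k") auto
    then show "x \<in> (!) ?ys ` {..<k}" using i by blast
  next
    fix x assume "x \<in> (!) ?ys ` {..<k}"
    then obtain i where i: "i < k" "x = ?ys ! i" by auto
    have "?ys ! k \<noteq> ?ys ! i" using i k dys len by (simp add: nth_eq_iff_index_eq del: distinct_rev)
    then have "?ys ! k < x" using mono[of i k] i k by (simp add: less_le)
    then show "x \<in> {x \<in> set xs. ?ys ! k < x}"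
      using i k len set by (metis (mono_tags, lifting) mem_Collect_eq nth_mem order_less_trans)
  qed
  moreover have "inj_on ((!) ?ys) {..<k}"
    using dys len k by (intro inj_on_nth) auto
  ultimately show ?thesis by (simp add: card_image)
qed

lemma card_exceed_emp_threshold:
  assumes "inj_on (\<lambda>i. norm (Xs i w)) {1..n}" "k < n"
  shows "card {i \<in> {1..n}. emp_threshold Xs n k w < norm (Xs i w)} = k"
proof -
  let ?xs = "map (\<lambda>i. norm (Xs i w)) [1..<n+1]"
  have set: "set ?xs = (\<lambda>i. norm (Xs i w)) ` {1..n}" by (simp add: atLeastLessThanSuc_atLeastAtMost del: upt_Suc)
  have "distinct ?xs" using assms(1) by (simp add: distinct_map atLeastLessThanSuc_atLeastAtMost del: upt_Suc)
  then have "card {x \<in> set ?xs. emp_threshold Xs n k w < x} = k"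
    unfolding emp_threshold_def by (rule card_greater_rev_sort_nth) (use assms(2) in simp)
  moreover have "{x \<in> set ?xs. emp_threshold Xs n k w < x}
    = (\<lambda>i. norm (Xs i w)) ` {i \<in> {1..n}. emp_threshold Xs n k w < norm (Xs i w)}"
    unfolding set by auto
  moreover have "inj_on (\<lambda>i. norm (Xs i w)) {i \<in> {1..n}. emp_threshold Xs n k w < norm (Xs i w)}"
    by (rule inj_on_subset[OF assms(1)]) auto
  ultimately show ?thesis by (simp add: card_image)
qed

text \<open>The two index sets are nested, so their symmetric difference has as many elements as their sizes differ.\<close>

lemma sum_exceed_diff:
  fixes f r :: "nat \<Rightarrow> real"
  assumes "\<And>i. i \<in> {1..n} \<Longrightarrow> \<bar>f i\<bar> \<le> B"
  shows "\<bar>(\<Sum>i=1..n. f i * of_bool (s < r i)) - (\<Sum>i=1..n. f i * of_bool (t < r i))\<bar>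
    \<le> B * \<bar>real (card {i \<in> {1..n}. s < r i}) - real (card {i \<in> {1..n}. t < r i})\<bar>"
proof -
  have card: "(\<Sum>i=1..n. of_bool (x < r i)) = real (card {i \<in> {1..n}. x < r i})" for x
    by (simp add: of_bool_def sum.If_cases Int_def)
  \<comment> \<open>For ordered thresholds the difference of the indicators has constant sign and
    sums to the difference of the counts; the other order follows by exchange.\<close>
  have *: "\<bar>(\<Sum>i=1..n. f i * of_bool (s < r i)) - (\<Sum>i=1..n. f i * of_bool (t < r i))\<bar>
    \<le> B * (real (card {i \<in> {1..n}. s < r i}) - real (card {i \<in> {1..n}. t < r i}))" if st: "s \<le> t" for s t
  proof -
    have "\<bar>(\<Sum>i=1..n. f i * of_bool (s < r i)) - (\<Sum>i=1..n. f i * of_bool (t < r i))\<bar>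
      \<le> (\<Sum>i=1..n. \<bar>f i * of_bool (s < r i) - f i * of_bool (t < r i)\<bar>)"
      unfolding sum_subtractf[symmetric] by (rule sum_abs)
    also have "\<dots> \<le> (\<Sum>i=1..n. B * (of_bool (s < r i) - of_bool (t < r i)))"
      by (rule sum_mono) (use assms st in auto)
    also have "\<dots> = B * ((\<Sum>i=1..n. of_bool (s < r i)) - (\<Sum>i=1..n. of_bool (t < r i)))"
      by (simp only: sum_subtractf[symmetric] sum_distrib_left)
    finally show ?thesis unfolding card .
  qed
  have mono: "card {i \<in> {1..n}. t < r i} \<le> card {i \<in> {1..n}. s < r i}" if "s \<le> t" for s t
    by (rule card_mono) (use that in auto)
  show ?thesis
  proof (cases "s \<le> t")
    case True
    then show ?thesis using *[OF True] mono[OF True] by simp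
  next
    case False
    then have ts: "t \<le> s" by simp
    show ?thesis using *[OF ts] mono[OF ts] by (simp add: abs_minus_commute)
  qed
qed

section \<open>Empirical and conditional second moment matrices\<close>

lemma norm_matrix_power2: "(norm A)\<^sup>2 = (\<Sum>a\<in>UNIV. \<Sum>b\<in>UNIV. (A $ a $ b)\<^sup>2)" for A :: "real^'n^'m"
  unfolding power2_norm_eq_inner by (simp add: inner_vec_def power2_eq_square)

lemma measurable_outer_square [measurable]: "outer_square \<in> borel_measurable borel"
  unfolding outer_square_def
  by (intro borel_measurable_continuous_onI continuous_intros)

lemma bounded_linear_entry: "bounded_linear (\<lambda>A :: real^'n^'m. A $ a $ b)"
  using bounded_linear_compose[OF bounded_linear_vec_nth bounded_linear_vec_nth] .

lemma entry_bound:
  fixes x :: "real^'d"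
  assumes "norm x \<le> B"
  shows "\<bar>x $ a * x $ b\<bar> \<le> B\<^sup>2"
  using mult_mono[OF order_trans[OF component_le_norm_cart assms] order_trans[OF component_le_norm_cart assms], of b a]
    norm_ge_zero[of x] assms
  by (simp add: abs_mult power2_eq_square)

lemma integrable_outer_square:
  fixes g :: "'a \<Rightarrow> real^'d"
  assumes "finite_measure L" and g: "g \<in> borel_measurable L" and B: "\<And>x. norm (g x) \<le> B"
  shows "integrable L (\<lambda>x. outer_square (g x))"
proof -
  interpret finite_measure L by fact
  show ?thesis
  proof (rule integrable_const_bound)
    show "AE x in L. norm (outer_square (g x)) \<le> B\<^sup>2"
    proof (rule AE_I2)
      fix x
      have "norm (outer_square v) = (norm v)\<^sup>2" for v :: "real^'d"
      proof -
        have "(norm (outer_square v))\<^sup>2 = ((norm v)\<^sup>2)\<^sup>2"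
          by (simp only: power2_norm_eq_inner inner_outer_square outer_square_mult)
            (simp add: power2_eq_square)
        then show ?thesis by (rule power2_eq_imp_eq) auto
      qed
      then show "norm (outer_square (g x)) \<le> B\<^sup>2" using B[of x] by (simp add: power_mono)
    qed
  qed (use g in measurable)
qed

lemma integral_outer_square_entry:
  fixes g :: "'a \<Rightarrow> real^'d"
  assumes "finite_measure L" and g: "g \<in> borel_measurable L" and B: "\<And>x. norm (g x) \<le> B"
  shows "(\<integral>x. outer_square (g x) \<partial>L) $ a $ b = (\<integral>x. g x $ a * g x $ b \<partial>L)"
  using integral_bounded_linear[OF bounded_linear_entry[of a b] integrable_outer_square[OF assms]]
  by (simp add: outer_square_def)

lemma transpose_eqI: "(\<And>a b. A $ a $ b = A $ b $ a) \<Longrightarrow> transpose A = A"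
  by (simp add: vec_eq_iff transpose_def)

text \<open>Makes the empirical risk a linear functional of the projection, so that the Ky Fan
  principle applies to its maximizers.\<close>

definition Sigma_emp ::
    "(nat \<Rightarrow> 'w \<Rightarrow> real^'d) \<Rightarrow> (real^'d \<Rightarrow> real) \<Rightarrow> nat \<Rightarrow> nat \<Rightarrow> 'w \<Rightarrow> real^'d^'d" where
  "Sigma_emp Xs \<omega> n k w = (1 / real k) *\<^sub>R (\<Sum>i=1..n.
    of_bool (emp_threshold Xs n k w < norm (Xs i w)) *\<^sub>R outer_square (rescaled \<omega> (Xs i w)))"

lemma emp_risk_eq: "emp_risk Xs \<omega> n k w V = Sigma_emp Xs \<omega> n k w \<bullet> proj_matrix V"
  by (simp add: emp_risk_def Sigma_emp_def inner_sum_left inner_commute[of "outer_square _"]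
      inner_outer_square mult.commute)

lemma Sigma_emp_entry:
  "Sigma_emp Xs \<omega> n k w $ a $ b = (1 / real k) * (\<Sum>i=1..n.
    rescaled \<omega> (Xs i w) $ a * rescaled \<omega> (Xs i w) $ b * of_bool (emp_threshold Xs n k w < norm (Xs i w)))"
  by (simp add: Sigma_emp_def outer_square_def mult_ac)

lemma transpose_Sigma_emp: "transpose (Sigma_emp Xs \<omega> n k w) = Sigma_emp Xs \<omega> n k w"
  by (rule transpose_eqI) (simp add: Sigma_emp_entry mult_ac)

text \<open>Of regular variation it retains only \<open>exceed_pos\<close>: it makes conditioning on
  an exceedance meaningful at every level and drives the thresholds to infinity.\<close>

locale exceedance_sample = prob_space M for M :: "'w measure" +
  fixes X :: "'w \<Rightarrow> real^'d" and Xs :: "nat \<Rightarrow> 'w \<Rightarrow> real^'d" and \<omega> :: "real^'d \<Rightarrow> real" and B :: real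
  assumes X_measurable [measurable]: "X \<in> borel_measurable M"
    and indep: "indep_vars (\<lambda>_. borel) Xs {1..}"
    and distr_Xs: "\<And>i. 1 \<le> i \<Longrightarrow> distr M borel (Xs i) = distr M borel X"
    and cont: "continuous_on UNIV (cdf (distr M borel (\<lambda>w. norm (X w))))"
    and \<omega>_measurable [measurable]: "\<omega> \<in> borel_measurable borel"
    and rescaled_bound: "\<And>x. norm (rescaled \<omega> x) \<le> B"
    and exceed_pos: "\<And>t. 0 < prob (exceedance M X t)"
begin

lemma rescaled_measurable [measurable]: "rescaled \<omega> \<in> borel_measurable borel"
  unfolding rescaled_def by measurable

lemma measurable_rescaled_entry: "(\<lambda>x. rescaled \<omega> x $ a) \<in> borel_measurable borel"
  by (rule measurable_compose[OF rescaled_measurable borel_measurable_continuous_onI])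
    (intro continuous_intros)

lemma Xs_measurable: "1 \<le> i \<Longrightarrow> Xs i \<in> borel_measurable M"
  using indep unfolding indep_vars_def2 by auto

lemma exceedance_sets [measurable]: "exceedance M X t \<in> sets M"
  unfolding exceedance_def by measurable

lemma prob_exceedance: "prob (exceedance M X t) = 1 - cdf (distr M borel (\<lambda>w. norm (X w))) t"
proof -
  have "cdf (distr M borel (\<lambda>w. norm (X w))) t = prob {w \<in> space M. norm (X w) \<le> t}"
    unfolding cdf_def by (subst measure_distr) (auto intro!: arg_cong[where f=prob])
  also have "{w \<in> space M. norm (X w) \<le> t} = space M - exceedance M X t"
    by (auto simp: exceedance_def)
  also have "prob \<dots> = 1 - prob (exceedance M X t)" by (rule prob_compl) measurable
  finally show ?thesis by simp
qed

lemma threshold_cdf: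
  assumes "1 \<le> k" "k < n"
  shows "prob (exceedance M X (threshold M X n k)) = real k / real n"
    and "\<And>t. real k / real n < prob (exceedance M X t) \<Longrightarrow> t \<le> threshold M X n k"
proof -
  have q: "0 < 1 - real k / real n" "1 - real k / real n < 1" using assms by (auto simp: field_simps)
  have m: "(\<lambda>w. norm (X w)) \<in> borel_measurable M" by measurable
  show "prob (exceedance M X (threshold M X n k)) = real k / real n"
    using cdf_quantile(1)[OF m cont q] by (simp add: prob_exceedance threshold_def)
  show "t \<le> threshold M X n k" if "real k / real n < prob (exceedance M X t)" for t
    unfolding threshold_def by (rule cdf_quantile(2)[OF m cont q]) (use that prob_exceedance[of t] in simp)
qed

text \<open>A fixed level is exceeded with a fixed positive probability, which eventually lies above
  \<open>k n / n\<close>; the threshold has then passed that level.\<close>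

lemma threshold_at_top:
  assumes k: "\<forall>n\<ge>2. k n \<in> {1..n-1}" and lim: "(\<lambda>n. real (k n) / real n) \<longlonglongrightarrow> 0"
  shows "filterlim (\<lambda>n. threshold M X n (k n)) at_top sequentially"
  unfolding filterlim_at_top
proof
  fix t
  have "\<forall>\<^sub>F n in sequentially. real (k n) / real n < prob (exceedance M X t)"
    by (rule order_tendstoD(2)[OF lim exceed_pos])
  then show "\<forall>\<^sub>F n in sequentially. t \<le> threshold M X n (k n)"
    using eventually_ge_at_top[of 2]
  proof eventually_elim
    case (elim n)
    then have "1 \<le> k n" "k n < n" using k by force+
    then show ?case using threshold_cdf(2) elim(1) by blast
  qed
qed

section \<open>Conditional moments given an exceedance\<close>

lemma cond_exceed_prob_space: "prob_space (cond_exceed M X t)"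
  unfolding cond_exceed_def
  by (rule prob_space_uniform_measure) (use exceed_pos[of t] in \<open>auto simp: emeasure_eq_measure\<close>)

lemma integral_cond_exceed:
  fixes f :: "'w \<Rightarrow> real"
  assumes [measurable]: "f \<in> borel_measurable M"
  shows "(\<integral>w. f w \<partial>cond_exceed M X t)
    = expectation (\<lambda>w. f w * of_bool (t < norm (X w))) / prob (exceedance M X t)"
proof -
  let ?A = "exceedance M X t"
  \<comment> \<open>The density is rewritten as a real quotient, the form in which a Bochner
    integral against it becomes an ordinary expectation.\<close>
  have "uniform_measure M ?A = density M (\<lambda>w. ennreal (indicator ?A w / prob ?A))"
    unfolding uniform_measure_def
    by (intro density_cong)
      (auto simp: emeasure_eq_measure exceed_pos divide_ennreal indicator_def
        simp flip: ennreal_1 intro!: AE_I2)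
  then have "(\<integral>w. f w \<partial>cond_exceed M X t) = (\<integral>w. (indicator ?A w / prob ?A) *\<^sub>R f w \<partial>M)"
    unfolding cond_exceed_def by (simp add: integral_density)
  also have "\<dots> = (\<integral>w. f w * of_bool (t < norm (X w)) / prob ?A \<partial>M)"
    by (rule Bochner_Integration.integral_cong) (auto simp: exceedance_def indicator_def)
  finally show ?thesis by simp
qed

lemma Sigma_cond_entry:
  "Sigma_cond M X \<omega> t $ a $ b =
    (\<integral>w. rescaled \<omega> (X w) $ a * rescaled \<omega> (X w) $ b \<partial>cond_exceed M X t)"
  unfolding Sigma_cond_def
proof (rule integral_outer_square_entry[OF _ _ rescaled_bound])
  show "finite_measure (cond_exceed M X t)"
    using cond_exceed_prob_space prob_space.finite_measure by blast
  show "(\<lambda>w. rescaled \<omega> (X w)) \<in> borel_measurable (cond_exceed M X t)"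
    unfolding cond_exceed_def by simp
qed

lemma transpose_Sigma_cond: "transpose (Sigma_cond M X \<omega> t) = Sigma_cond M X \<omega> t"
  by (rule transpose_eqI) (simp add: Sigma_cond_entry mult.commute)

lemma expectation_Xs:
  fixes f :: "real^'d \<Rightarrow> real"
  assumes [measurable]: "f \<in> borel_measurable borel" and i: "1 \<le> i"
  shows "expectation (\<lambda>w. f (Xs i w)) = expectation (\<lambda>w. f (X w))"
proof -
  have [measurable]: "Xs i \<in> borel_measurable M" by (rule Xs_measurable[OF i])
  have "expectation (\<lambda>w. f (Xs i w)) = (\<integral>x. f x \<partial>distr M borel (Xs i))"
    by (simp add: integral_distr)
  also have "\<dots> = expectation (\<lambda>w. f (X w))" by (simp add: distr_Xs[OF i] integral_distr)
  finally show ?thesis .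
qed

text \<open>An exceedance has probability \<open>k / n\<close>, so the second moments of the
  \<open>n\<close> summands add up to at most \<open>k\<close> times the square of \<open>b\<close>.
  Fluctuations are therefore of order \<open>sqrt k\<close>.\<close>

lemma exceed_sum_deviation:
  fixes f :: "real^'d \<Rightarrow> real" and n k :: nat
  defines "t \<equiv> threshold M X n k"
  assumes f [measurable]: "f \<in> borel_measurable borel" and b: "\<And>x. \<bar>f x\<bar> \<le> b"
    and k: "1 \<le> k" "k < n" and H: "0 < H"
  shows "prob {w \<in> space M. H * sqrt (real k) \<le>
      \<bar>(\<Sum>i=1..n. f (Xs i w) * of_bool (t < norm (Xs i w)))
        - real k * (\<integral>w. f (X w) \<partial>cond_exceed M X t)\<bar>} \<le> b\<^sup>2 / H\<^sup>2"
proof -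
  define g where "g = (\<lambda>x. f x * of_bool (t < norm x))"
  have gm [measurable]: "g \<in> borel_measurable borel" unfolding g_def by measurable
  have pr: "prob (exceedance M X t) = real k / real n" unfolding t_def by (rule threshold_cdf(1)[OF k])
  have b0: "0 \<le> b" using b[of 0] by linarith
  define m where "m = expectation (\<lambda>w. g (X w))"
  have m: "real n * m = real k * (\<integral>w. f (X w) \<partial>cond_exceed M X t)"
    using k by (simp add: integral_cond_exceed pr m_def g_def)
  have "prob {w \<in> space M. H * sqrt (real k) \<le> \<bar>(\<Sum>i\<in>{1..n}. g (Xs i w)) - real (card {1..n}) * m\<bar>}
    \<le> real (card {1..n}) * (b\<^sup>2 * (real k / real n)) / (H * sqrt (real k))\<^sup>2"
  proof (rule indep_sum_deviation)
    show "indep_vars (\<lambda>_. borel) (\<lambda>i w. g (Xs i w)) {1..n}"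
      by (rule indep_vars_compose2[OF indep_vars_subset[OF indep]]) auto
    show "\<bar>g (Xs i w)\<bar> \<le> b" for i w using b[of "Xs i w"] b0 by (simp add: g_def)
    show "expectation (\<lambda>w. g (Xs i w)) = m" if "i \<in> {1..n}" for i
      unfolding m_def by (rule expectation_Xs) (use that in auto)
    show "expectation (\<lambda>w. (g (Xs i w))\<^sup>2) \<le> b\<^sup>2 * (real k / real n)" if "i \<in> {1..n}" for i
    proof -
      have "expectation (\<lambda>w. (g (Xs i w))\<^sup>2) = expectation (\<lambda>w. (g (X w))\<^sup>2)"
        by (rule expectation_Xs[where f="\<lambda>x. (g x)\<^sup>2"]) (use that in auto)
      also have "\<dots> \<le> expectation (\<lambda>w. b\<^sup>2 * indicator (exceedance M X t) w)"
      proof (rule integral_mono)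
        show "integrable M (\<lambda>w. (g (X w))\<^sup>2)"
          by (rule bounded_square_integrable[of _ b]) (use b b0 in \<open>auto simp: g_def\<close>)
        show "(g (X w))\<^sup>2 \<le> b\<^sup>2 * indicator (exceedance M X t) w" if "w \<in> space M" for w
          using that power_mono[OF b[of "X w"], of 2] by (auto simp: g_def exceedance_def)
        show "integrable M (\<lambda>w. b\<^sup>2 * indicator (exceedance M X t) w :: real)"
          by (intro integrable_mult_right integrable_real_indicator) (auto simp: emeasure_eq_measure)
      qed
      also have "\<dots> = b\<^sup>2 * (real k / real n)" using pr by simp
      finally show ?thesis .
    qed
    show "0 < H * sqrt (real k)" using H k by simp
  qed simp
  also have "\<dots> = b\<^sup>2 / H\<^sup>2" using k by (simp add: power_mult_distrib)
  finally show ?thesis unfolding g_def by (simp add: m[unfolded g_def])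
qed

text \<open>A continuous distribution function has no atoms, so two independent norms almost surely
  differ; there are finitely many pairs.\<close>

lemma AE_inj_norm: "AE w in M. inj_on (\<lambda>i. norm (Xs i w)) {1..n}"
proof -
  have "AE w in M. norm (Xs i w) \<noteq> norm (Xs j w)" if ij: "1 \<le> i" "1 \<le> j" "i \<noteq> j" for i j
  proof (rule AE_indep_neq)
    \<comment> \<open>The index set is written this way so that independence of one variable from a
      sum over the others applies; here that sum has a single term.\<close>
    have "indep_vars (\<lambda>_. borel) (\<lambda>i w. norm (Xs i w)) (insert i {j})"
      by (rule indep_vars_compose2[OF indep_vars_subset[OF indep]]) (use ij in auto)
    from indep_vars_sum[OF _ _ this] show "indep_var borel (\<lambda>w. norm (Xs i w)) borel (\<lambda>w. norm (Xs j w))"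
      using ij by simp
    fix x
    have [measurable]: "Xs i \<in> borel_measurable M" by (rule Xs_measurable[OF ij(1)])
    interpret R: real_distribution "distr M borel (\<lambda>w. norm (X w))"
      by (intro real_distribution.intro prob_space_distr) (auto simp: real_distribution_axioms_def)
    have "distr M borel (\<lambda>w. norm (Xs i w)) = distr (distr M borel (Xs i)) borel norm"
      by (simp add: distr_distr comp_def)
    also have "\<dots> = distr M borel (\<lambda>w. norm (X w))"
      by (simp add: distr_Xs[OF ij(1)] distr_distr comp_def)
    finally show "measure (distr M borel (\<lambda>w. norm (Xs i w))) {x} = 0"
      using R.isCont_cdf[of x] cont by (simp add: continuous_on_eq_continuous_at)
  qed
  then have "AE w in M. \<forall>i\<in>{1..n}. \<forall>j\<in>{1..n}. i \<noteq> j \<longrightarrow> norm (Xs i w) \<noteq> norm (Xs j w)"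
    by (intro AE_finite_allI) (auto intro: AE_impI)
  then show ?thesis by eventually_elim (auto simp: inj_on_def)
qed

text \<open>The conditional second moments concentrate at rate \<open>k\<^sup>-\<^sup>1\<^sup>/\<^sup>2\<close> for the deterministic threshold, by
  Chebyshev. Passing to the random threshold changes at most \<open>\<bar>N - k\<bar>\<close> summands, where \<open>N\<close> counts the
  exceedances of the deterministic one, and \<open>N\<close> concentrates around \<open>k\<close> at the same rate.\<close>

lemma Sigma_emp_deviation:
  assumes \<epsilon>: "0 < \<epsilon>"
  shows "\<exists>K. \<forall>n k. 1 \<le> k \<longrightarrow> k < n \<longrightarrow> (\<exists>E\<in>sets M. prob E \<le> \<epsilon> \<and>
    (\<forall>w\<in>space M - E. (norm (Sigma_emp Xs \<omega> n k w - Sigma_nk M X \<omega> n k))\<^sup>2 \<le> K / real k))"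
proof -
  let ?d = "real CARD('d)"
  \<comment> \<open>A common bound for the entries and for the constant function 1, whose exceedance
    sum is the number of exceedances.\<close>
  define \<beta> where "\<beta> = max 1 (B\<^sup>2)"
  have \<beta>: "1 \<le> \<beta>" "B\<^sup>2 \<le> \<beta>" by (auto simp: \<beta>_def)
  \<comment> \<open>Chosen so that the failure probabilities, one for each matrix entry and one for
    the count, add up to \<epsilon>.\<close>
  define H where "H = sqrt ((?d * ?d + 1) * \<beta>\<^sup>2 / \<epsilon>)"
  have arg: "0 < (?d * ?d + 1) * \<beta>\<^sup>2 / \<epsilon>" using \<epsilon> \<beta> by (intro divide_pos_pos mult_pos_pos add_nonneg_pos) auto
  then have H: "0 < H" "H\<^sup>2 = (?d * ?d + 1) * \<beta>\<^sup>2 / \<epsilon>" by (simp_all add: H_def)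
  have total: "(?d * ?d + 1) * (\<beta>\<^sup>2 / H\<^sup>2) = \<epsilon>"
  proof -
    have "H\<^sup>2 * \<epsilon> = (?d * ?d + 1) * \<beta>\<^sup>2" using H(2) \<epsilon> by simp
    then show ?thesis using H(1) by (simp add: field_simps)
  qed
  show ?thesis
  proof (intro exI[of _ "?d * ?d * ((1 + \<beta>) * H)\<^sup>2"] allI impI)
    fix n k :: nat assume k: "1 \<le> k" "k < n"
    define t where "t = threshold M X n k"
    let ?f = "\<lambda>a b x. rescaled \<omega> x $ a * rescaled \<omega> x $ b"
    define dev where "dev = (\<lambda>f w. \<bar>(\<Sum>i=1..n. f (Xs i w) * of_bool (t < norm (Xs i w)))
        - real k * (\<integral>w. f (X w) \<partial>cond_exceed M X t)\<bar>)"
    define D where "D = (\<lambda>f. {w \<in> space M. H * sqrt (real k) \<le> dev f w})"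
    have fb: "\<bar>?f a b x\<bar> \<le> \<beta>" for a b x using entry_bound[OF rescaled_bound, of x a b] \<beta> by simp
    have fm: "?f a b \<in> borel_measurable borel" for a b
      using measurable_rescaled_entry[measurable] by measurable
    have D_le: "prob (D f) \<le> \<beta>\<^sup>2 / H\<^sup>2" if "f \<in> borel_measurable borel" "\<And>x. \<bar>f x\<bar> \<le> \<beta>" for f
      unfolding D_def dev_def t_def by (rule exceed_sum_deviation[OF that k H(1)])
    have D_sets: "D f \<in> sets M" if [measurable]: "f \<in> borel_measurable borel" for f :: "real^'d \<Rightarrow> real"
    proof -
      have "(\<lambda>w. \<Sum>i=1..n. f (Xs i w) * of_bool (t < norm (Xs i w))) \<in> borel_measurable M"
      proof (rule borel_measurable_sum)
        fix i assume "i \<in> {1..n}"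
        then have [measurable]: "Xs i \<in> borel_measurable M" by (intro Xs_measurable) simp
        show "(\<lambda>w. f (Xs i w) * of_bool (t < norm (Xs i w))) \<in> borel_measurable M" by measurable
      qed
      then show ?thesis unfolding D_def dev_def by measurable
    qed
    obtain N where N: "{w \<in> space M. \<not> inj_on (\<lambda>i. norm (Xs i w)) {1..n}} \<subseteq> N" "N \<in> sets M" "emeasure M N = 0"
      using AE_E[OF AE_inj_norm[of n]] by blast
    define U where "U = (\<Union>ab\<in>UNIV. D (?f (fst ab) (snd ab)))"
    \<comment> \<open>Exceptional event: ties among the norms, a badly deviating count, or a badly
      deviating entry.\<close>
    define E where "E = N \<union> (D (\<lambda>_. 1) \<union> U)"
    have U_sets: "U \<in> sets M" unfolding U_def by (intro sets.finite_UN D_sets fm) auto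
    have one: "D (\<lambda>_. 1) \<in> sets M" by (rule D_sets) simp
    have "E \<in> sets M" unfolding E_def using N U_sets one by auto
    moreover have "prob E \<le> \<epsilon>"
    proof -
      have "prob U \<le> (\<Sum>ab\<in>(UNIV :: ('d \<times> 'd) set). prob (D (?f (fst ab) (snd ab))))"
        unfolding U_def by (rule finite_measure_subadditive_finite) (use D_sets fm in auto)
      also have "\<dots> \<le> (\<Sum>ab\<in>(UNIV :: ('d \<times> 'd) set). \<beta>\<^sup>2 / H\<^sup>2)"
        by (rule sum_mono) (rule D_le[OF fm fb])
      also have "\<dots> = ?d * ?d * (\<beta>\<^sup>2 / H\<^sup>2)" by (simp add: UNIV_Times_UNIV[symmetric] card_cartesian_product del: UNIV_Times_UNIV)
      finally have U: "prob U \<le> ?d * ?d * (\<beta>\<^sup>2 / H\<^sup>2)" .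
      have "prob E \<le> prob N + prob (D (\<lambda>_. 1) \<union> U)"
        unfolding E_def by (rule measure_Un_le) (use N one U_sets in auto)
      also have "\<dots> \<le> 0 + (prob (D (\<lambda>_. 1)) + prob U)"
        using N(3) by (intro add_mono measure_Un_le one U_sets) (simp add: measure_def)
      also have "\<dots> \<le> \<beta>\<^sup>2 / H\<^sup>2 + ?d * ?d * (\<beta>\<^sup>2 / H\<^sup>2)"
        using U D_le[of "\<lambda>_. 1"] \<beta>(1) by simp
      also have "\<dots> = (?d * ?d + 1) * (\<beta>\<^sup>2 / H\<^sup>2)"
        by (simp only: distrib_right mult_1 add.commute)
      also note total
      finally show ?thesis .
    qed
    moreover have "(norm (Sigma_emp Xs \<omega> n k w - Sigma_nk M X \<omega> n k))\<^sup>2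
        \<le> (?d * ?d * ((1 + \<beta>) * H)\<^sup>2) / real k" if w: "w \<in> space M - E" for w
    proof -
      define s where "s = emp_threshold Xs n k w"
      have inj: "inj_on (\<lambda>i. norm (Xs i w)) {1..n}" using w N(1) unfolding E_def by blast
      have cs: "card {i \<in> {1..n}. s < norm (Xs i w)} = k"
        unfolding s_def by (rule card_exceed_emp_threshold[where Xs=Xs and w=w, OF inj k(2)])
      \<comment> \<open>The deviation for the constant function controls the count at the
        deterministic threshold, whereas the empirical threshold has exactly \<open>k\<close>
        exceedances.\<close>
      have "dev (\<lambda>_. 1) w < H * sqrt (real k)" using w unfolding E_def D_def by auto
      moreover have "(\<Sum>i=1..n. 1 * of_bool (t < norm (Xs i w))) = real (card {i \<in> {1..n}. t < norm (Xs i w)})"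
        by (simp add: of_bool_def sum.If_cases Int_def)
      moreover have "(\<integral>w. 1 \<partial>cond_exceed M X t) = (1::real)"
        using prob_space.prob_space[OF cond_exceed_prob_space] by simp
      ultimately have ct: "\<bar>real k - real (card {i \<in> {1..n}. t < norm (Xs i w)})\<bar> \<le> H * sqrt (real k)"
        unfolding dev_def by simp
      have entry: "((Sigma_emp Xs \<omega> n k w - Sigma_nk M X \<omega> n k) $ a $ b)\<^sup>2 \<le> ((1 + \<beta>) * H)\<^sup>2 / real k" for a b
      proof -
        let ?T = "\<lambda>s. \<Sum>i=1..n. ?f a b (Xs i w) * of_bool (s < norm (Xs i w))"
        let ?e = "Sigma_emp Xs \<omega> n k w $ a $ b" and ?m = "Sigma_nk M X \<omega> n k $ a $ b"
        have "w \<notin> D (?f a b)" using w unfolding E_def U_def by force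
        then have 1: "\<bar>?T t - real k * ?m\<bar> \<le> H * sqrt (real k)"
          using w unfolding D_def dev_def Sigma_nk_def t_def[symmetric] Sigma_cond_entry by auto
        \<comment> \<open>Changing the threshold costs \<beta> times the count deviation. Added to
          the deviation at the deterministic threshold this gives the factor
          \<open>1 + \<beta>\<close>.\<close>
        have "\<bar>?T s - ?T t\<bar> \<le> \<beta> * \<bar>real k - real (card {i \<in> {1..n}. t < norm (Xs i w)})\<bar>"
          unfolding cs[symmetric] by (rule sum_exceed_diff) (rule fb)
        also have "\<dots> \<le> \<beta> * (H * sqrt (real k))" using ct \<beta>(1) by (intro mult_left_mono) auto
        finally have "\<bar>?T s - real k * ?m\<bar> \<le> (1 + \<beta>) * H * sqrt (real k)"
          using 1 by (simp add: algebra_simps)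
        moreover have "?T s = real k * ?e" using k by (simp add: Sigma_emp_entry s_def)
        ultimately have "\<bar>real k * (?e - ?m)\<bar> \<le> (1 + \<beta>) * H * sqrt (real k)"
          by (simp add: right_diff_distrib)
        then have "(real k * (?e - ?m))\<^sup>2 \<le> ((1 + \<beta>) * H * sqrt (real k))\<^sup>2"
          using power_mono[of "\<bar>real k * (?e - ?m)\<bar>" _ 2] by simp
        then have "real k * (real k * (?e - ?m)\<^sup>2) \<le> real k * ((1 + \<beta>) * H)\<^sup>2"
          by (simp add: power_mult_distrib power2_eq_square[of "real k"] mult_ac)
        then have "real k * (?e - ?m)\<^sup>2 \<le> ((1 + \<beta>) * H)\<^sup>2"
          by (rule mult_left_le_imp_le) (use k in simp)
        then show ?thesis using k by (simp add: field_simps)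
      qed
      have "(norm (Sigma_emp Xs \<omega> n k w - Sigma_nk M X \<omega> n k))\<^sup>2
        \<le> (\<Sum>a\<in>(UNIV::'d set). \<Sum>b\<in>(UNIV::'d set). ((1 + \<beta>) * H)\<^sup>2 / real k)"
        unfolding norm_matrix_power2 by (intro sum_mono entry)
      then show ?thesis by simp
    qed
    ultimately show "\<exists>E\<in>sets M. prob E \<le> \<epsilon> \<and>
      (\<forall>w\<in>space M - E. (norm (Sigma_emp Xs \<omega> n k w - Sigma_nk M X \<omega> n k))\<^sup>2
        \<le> (?d * ?d * ((1 + \<beta>) * H)\<^sup>2) / real k)" by blast
  qed
qed

end

section \<open>Convergence of the conditional second moment matrix\<close>

text \<open>Weak convergence tests only bounded continuous functions, and a product of coordinates
  is unbounded. Clipping at the squared bound on the rescaled vectors repairs this without changing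
  any value they attain.\<close>

definition clipped_product :: "real \<Rightarrow> 'd \<Rightarrow> 'd \<Rightarrow> real^'d \<Rightarrow> real" where
  "clipped_product c a b x = max (- c) (min c (x $ a * x $ b))"

lemma clipped_product_eq: "norm x \<le> B \<Longrightarrow> clipped_product (B\<^sup>2) a b x = x $ a * x $ b"
  using entry_bound[of x B a b] by (auto simp: clipped_product_def min_def max_def abs_le_iff)

lemma continuous_clipped_product: "continuous_on UNIV (clipped_product c a b)"
  unfolding clipped_product_def by (intro continuous_intros)

lemma bounded_clipped_product: "bounded (range (clipped_product c a b))"
  by (rule boundedI[of _ "\<bar>c\<bar>"]) (auto simp: clipped_product_def min_def max_def)

lemma integral_clipped_product_distr:
  assumes g: "g \<in> borel_measurable L" and B: "\<And>x. norm (g x) \<le> B"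
  shows "(\<integral>y. clipped_product (B\<^sup>2) a b y \<partial>distr L borel g) = (\<integral>x. g x $ a * g x $ b \<partial>L)"
  by (subst integral_distr[OF g borel_measurable_continuous_onI[OF continuous_clipped_product]])
    (simp add: clipped_product_eq[OF B])

text \<open>The region outside the unit ball is bounded away from the origin, so regular variation
  gives it finite mass.\<close>

lemma limit_model_finite_measurable:
  fixes \<mu> :: "(real^'d) measure" and f :: "real^'d \<Rightarrow> 'b::topological_space"
  assumes "regularly_varying M X \<mu>"
  shows "finite_measure (limit_model \<mu>)"
    and "f \<in> borel_measurable borel \<Longrightarrow> f \<in> borel_measurable (limit_model \<mu>)"
proof -
  let ?A = "{x :: real^'d. 1 < norm x}"
  have sets: "sets \<mu> = sets (restrict_space borel (- {0}))"
    and fin: "\<And>B. B \<in> sets borel \<Longrightarrow> 0 \<notin> closure B \<Longrightarrow> emeasure \<mu> B < \<infinity>"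
    using assms unfolding regularly_varying_def by blast+
  have space: "space \<mu> = - {0}" using sets_eq_imp_space_eq[OF sets] by (simp add: space_restrict_space)
  have Ab: "?A \<in> sets borel" by measurable
  have "closure ?A \<subseteq> {x. 1 \<le> norm x}"
    by (intro closure_minimal closed_Collect_le continuous_intros) auto
  then have "emeasure \<mu> ?A < \<infinity>" by (intro fin Ab) auto
  moreover have Am: "?A \<inter> space \<mu> \<in> sets \<mu>"
    unfolding sets space sets_restrict_space using Ab by auto
  moreover have A_sub: "?A \<subseteq> space \<mu>" unfolding space by auto
  ultimately have "emeasure (limit_model \<mu>) (space (limit_model \<mu>)) \<noteq> \<infinity>"
    unfolding limit_model_def by (simp add: emeasure_restrict_space space_restrict_space Int_absorb2)
  then show "finite_measure (limit_model \<mu>)" by (rule finite_measureI)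
  assume "f \<in> borel_measurable borel"
  then have "f \<in> borel_measurable \<mu>"
    using measurable_restrict_space1[of f borel borel "- {0}"] measurable_cong_sets[OF sets refl] by blast
  then show "f \<in> borel_measurable (limit_model \<mu>)"
    unfolding limit_model_def by (rule measurable_restrict_space1)
qed

context exceedance_sample
begin

lemma Sigma_cond_tendsto:
  assumes rv: "regularly_varying M X \<mu>"
    and weak: "weakly_converges
           (\<lambda>t. distr (cond_exceed M X t) borel (\<lambda>w. rescaled \<omega> (X w)))
           (distr (limit_model \<mu>) borel (rescaled \<omega>)) at_top"
  shows "(Sigma_cond M X \<omega> \<longlongrightarrow> Sigma_lim \<mu> \<omega>) at_top"
proof (intro vec_tendstoI)
  fix a b
  have 1: "(\<lambda>w. rescaled \<omega> (X w)) \<in> borel_measurable (cond_exceed M X t)" for t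
    unfolding cond_exceed_def by simp
  have 2: "rescaled \<omega> \<in> borel_measurable (limit_model \<mu>)"
    by (rule limit_model_finite_measurable(2)[OF rv rescaled_measurable])
  have "((\<lambda>t. \<integral>y. clipped_product (B\<^sup>2) a b y \<partial>distr (cond_exceed M X t) borel (\<lambda>w. rescaled \<omega> (X w)))
    \<longlongrightarrow> (\<integral>y. clipped_product (B\<^sup>2) a b y \<partial>distr (limit_model \<mu>) borel (rescaled \<omega>))) at_top"
    using weak continuous_clipped_product bounded_clipped_product unfolding weakly_converges_def by blast
  then show "((\<lambda>t. Sigma_cond M X \<omega> t $ a $ b) \<longlongrightarrow> Sigma_lim \<mu> \<omega> $ a $ b) at_top"
    unfolding integral_clipped_product_distr[OF 1 rescaled_bound] integral_clipped_product_distr[OF 2 rescaled_bound]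
      Sigma_cond_entry Sigma_lim_def
      integral_outer_square_entry[OF limit_model_finite_measurable(1)[OF rv] 2 rescaled_bound] .
qed

lemma transpose_Sigma_lim:
  assumes rv: "regularly_varying M X \<mu>"
  shows "transpose (Sigma_lim \<mu> \<omega>) = Sigma_lim \<mu> \<omega>"
  unfolding Sigma_lim_def
  by (rule transpose_eqI)
    (simp add: integral_outer_square_entry[OF limit_model_finite_measurable(1)[OF rv]
        limit_model_finite_measurable(2)[OF rv rescaled_measurable] rescaled_bound] mult.commute)

section \<open>The excess risk of empirical maximizers\<close>

lemma excess_risk_bigO_gap_rate:
  assumes p: "p \<in> {1..CARD('d) - 1}" and k: "\<forall>n\<ge>2. k n \<in> {1..n-1}"
    and Vhat: "\<forall>n\<ge>2. \<forall>w\<in>space M.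
           is_arg_max (emp_risk Xs \<omega> n (k n) w) (\<lambda>V. V \<in> subspaces_of_dim p) (Vhat n w)"
  shows "bigO_prob M (\<lambda>n w. excess_risk (Sigma_nk M X \<omega> n (k n)) p (Vhat n w))
    (\<lambda>n. gap_rate (Sigma_nk M X \<omega> n (k n)) (k n) p)"
  unfolding bigO_prob_def
proof (intro allI impI)
  fix \<epsilon> :: real assume \<epsilon>: "0 < \<epsilon>"
  let ?d = "real CARD('d)"
  obtain K where K: "\<And>n k. 1 \<le> k \<Longrightarrow> k < n \<Longrightarrow> \<exists>E\<in>sets M. prob E \<le> \<epsilon> \<and>
    (\<forall>w\<in>space M - E. (norm (Sigma_emp Xs \<omega> n k w - Sigma_nk M X \<omega> n k))\<^sup>2 \<le> K / real k)"
    using Sigma_emp_deviation[OF \<epsilon>] by blast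
  \<comment> \<open>\<open>K\<close> depends on \<epsilon> but not on the sample size, hence so does
    \<open>C\<close>.\<close>
  define C where "C = max (2 * ?d) ((1 + 2 * ?d\<^sup>2)\<^sup>2 * ?d * K)"
  have C: "0 < C" "2 * ?d \<le> C" "(1 + 2 * ?d\<^sup>2)\<^sup>2 * ?d * K \<le> C" by (auto simp: C_def less_max_iff_disj)
  have "outer_measure_of M {w \<in> space M. ereal C * gap_rate (Sigma_nk M X \<omega> n (k n)) (k n) p
      < ereal \<bar>excess_risk (Sigma_nk M X \<omega> n (k n)) p (Vhat n w)\<bar>} \<le> ennreal \<epsilon>" if n: "2 \<le> n" for n
  proof -
    let ?S = "Sigma_nk M X \<omega> n (k n)"
    have kn: "1 \<le> k n" "k n < n" using k n by force+
    obtain E where E: "E \<in> sets M" "prob E \<le> \<epsilon>"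
      and dev: "\<And>w. w \<in> space M - E \<Longrightarrow> (norm (Sigma_emp Xs \<omega> n (k n) w - ?S))\<^sup>2 \<le> K / real (k n)"
      using K[OF kn] by blast
    obtain u l where S: "eigenframe ?S u l"
      unfolding Sigma_nk_def by (rule symmetric_eigenframe[OF transpose_Sigma_cond])
    have "ereal \<bar>excess_risk ?S p (Vhat n w)\<bar> \<le> ereal C * gap_rate ?S (k n) p" if w: "w \<in> space M - E" for w
    proof -
      let ?T = "Sigma_emp Xs \<omega> n (k n) w"
      obtain v t where T: "eigenframe ?T v t"
        by (rule symmetric_eigenframe[OF transpose_Sigma_emp])
      have V: "Vhat n w \<in> subspaces_of_dim p"
        and opt: "\<And>V. V \<in> subspaces_of_dim p \<Longrightarrow> ?T \<bullet> proj_matrix V \<le> ?T \<bullet> proj_matrix (Vhat n w)"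
      proof -
        have "is_arg_max (emp_risk Xs \<omega> n (k n) w) (\<lambda>V. V \<in> subspaces_of_dim p) (Vhat n w)"
          using Vhat n w by blast
        then show "Vhat n w \<in> subspaces_of_dim p"
          and "\<And>V. V \<in> subspaces_of_dim p \<Longrightarrow> ?T \<bullet> proj_matrix V \<le> ?T \<bullet> proj_matrix (Vhat n w)"
          unfolding is_arg_max_def emp_risk_eq by (blast, meson not_less)
      qed
      \<comment> \<open>The empirical maximizer is at least as good as a subspace attaining the Ky
        Fan sum, so it attains that sum itself.\<close>
      obtain V' where "V' \<in> subspaces_of_dim p" "?T \<bullet> proj_matrix V' = (\<Sum>m=1..p. t m)"
        using ky_fan_attained[OF T subspaces_of_dim_le[OF V]] .
      then have max: "?T \<bullet> proj_matrix (Vhat n w) = (\<Sum>m=1..p. t m)"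
        using opt[of V'] ky_fan[OF T V] by simp
      have "0 \<le> excess_risk ?S p (Vhat n w)" unfolding excess_risk_eq[OF S V] using ky_fan[OF S V] by simp
      then show ?thesis
        using excess_le_gap_rate[OF S T V p _ max dev[OF w] C(2,3)] kn by simp
    qed
    \<comment> \<open>The failure set depends on an arbitrary choice of maximizers; it is covered by
      the measurable event \<open>E\<close>, which bounds its outer measure.\<close>
    then have "{w \<in> space M. ereal C * gap_rate ?S (k n) p < ereal \<bar>excess_risk ?S p (Vhat n w)\<bar>} \<subseteq> E"
      by (auto simp: not_less[symmetric])
    then have "outer_measure_of M {w \<in> space M. ereal C * gap_rate ?S (k n) p < ereal \<bar>excess_risk ?S p (Vhat n w)\<bar>}
      \<le> outer_measure_of M E" by (rule outer_measure_of_mono)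
    also have "\<dots> \<le> ennreal \<epsilon>" using E by (simp add: emeasure_eq_measure ennreal_leI)
    finally show ?thesis .
  qed
  then show "\<exists>C>0. \<forall>\<^sub>F n in sequentially.
      outer_measure_of M {w \<in> space M. ereal C * gap_rate (Sigma_nk M X \<omega> n (k n)) (k n) p
      < ereal \<bar>excess_risk (Sigma_nk M X \<omega> n (k n)) p (Vhat n w)\<bar>} \<le> ennreal \<epsilon>"
    using C(1) by (intro exI[of _ C]) (auto intro: eventually_sequentiallyI[of 2])
qed

text \<open>By Lipschitz continuity of the eigenvalues, positive gaps next to the limiting block
  persist for large \<open>n\<close>, with a common lower bound.\<close>

lemma gap_rate_eventually_le:
  assumes p: "p \<in> {1..CARD('d) - 1}" and k: "\<forall>n\<ge>2. k n \<in> {1..n-1}"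
    and lim: "(\<lambda>n. Sigma_nk M X \<omega> n (k n)) \<longlonglongrightarrow> \<Sigma>" and \<Sigma>: "eigenframe \<Sigma> v m"
    and N: "N0 < p" "p \<le> N1" "N1 \<le> CARD('d)"
    and g0: "1 \<le> N0 \<Longrightarrow> m p < m N0" and g1: "N1 < CARD('d) \<Longrightarrow> m (N1 + 1) < m p"
  obtains C where "0 < C" "\<forall>\<^sub>F n in sequentially. gap_rate (Sigma_nk M X \<omega> n (k n)) (k n) p \<le>
    ereal C * (ereal (1 / real (k n)) + min (ereal (real (k n) powr (-1/2)))
      (eigval (Sigma_nk M X \<omega> n (k n)) (N0 + 1) - eigval (Sigma_nk M X \<omega> n (k n)) N1))"
proof -
  let ?d = "real CARD('d)"
  \<comment> \<open>Half the smaller limiting gap next to the block; a side without a neighbour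
    contributes the default 1.\<close>
  define g where "g = min (if 1 \<le> N0 then m N0 - m p else 1) (if N1 < CARD('d) then m p - m (N1 + 1) else 1) / 2"
  have g: "0 < g" using g0 g1 by (auto simp: g_def)
  have gm: "1 \<le> N0 \<Longrightarrow> 2 * g \<le> m N0 - m p" "N1 < CARD('d) \<Longrightarrow> 2 * g \<le> m p - m (N1 + 1)"
    by (auto simp: g_def)
  \<comment> \<open>At this distance each eigenvalue moves by at most \<open>g / 2\<close>, so a
    limiting gap of at least \<open>2 * g\<close> retains at least \<open>g\<close>.\<close>
  have "\<forall>\<^sub>F n in sequentially. dist (Sigma_nk M X \<omega> n (k n)) \<Sigma> < g / (4 * ?d)"
    using lim g by (intro tendstoD) auto
  then have "\<forall>\<^sub>F n in sequentially. gap_rate (Sigma_nk M X \<omega> n (k n)) (k n) p \<le>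
    ereal (max 4 (2 / g)) * (ereal (1 / real (k n)) + min (ereal (real (k n) powr (-1/2)))
      (eigval (Sigma_nk M X \<omega> n (k n)) (N0 + 1) - eigval (Sigma_nk M X \<omega> n (k n)) N1))"
    using eventually_ge_at_top[of 2]
  proof eventually_elim
    case (elim n)
    let ?S = "Sigma_nk M X \<omega> n (k n)"
    obtain u l where S: "eigenframe ?S u l"
      unfolding Sigma_nk_def by (rule symmetric_eigenframe[OF transpose_Sigma_cond])
    have kn: "0 < k n" using k elim(2) by force
    have near: "\<bar>l i - m i\<bar> \<le> g / 2" if "i \<in> {1..CARD('d)}" for i
    proof -
      have "\<bar>l i - m i\<bar> \<le> 2 * ?d * norm (?S - \<Sigma>)" by (rule eigenvalue_lipschitz[OF S \<Sigma> that])
      also have "\<dots> \<le> 2 * ?d * (g / (4 * ?d))"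
        using elim(1) by (intro mult_left_mono) (auto simp: dist_norm)
      finally show ?thesis by simp
    qed
    have np: "\<bar>l p - m p\<bar> \<le> g / 2" using near[of p] p by auto
    show ?case
    proof (rule gap_rate_le_block_rate[OF S p kn N g])
      show "g \<le> l N0 - l p" if "1 \<le> N0"
      proof -
        have "\<bar>l N0 - m N0\<bar> \<le> g / 2" using that N by (intro near) auto
        then show ?thesis using np gm(1)[OF that] unfolding abs_le_iff by linarith
      qed
      show "g \<le> l p - l (N1 + 1)" if "N1 < CARD('d)"
      proof -
        have "\<bar>l (N1 + 1) - m (N1 + 1)\<bar> \<le> g / 2" using that N by (intro near) auto
        then show ?thesis using np gm(2)[OF that] unfolding abs_le_iff by linarith
      qed
    qed
  qed
  then show ?thesis by (intro that[of "max 4 (2 / g)"]) auto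
qed

end

section \<open>Assembly: limiting eigenvalue blocks and the two rates\<close>

theorem corollary4p3:
  fixes M :: "'w measure"
    and X :: "'w \<Rightarrow> real^'d"
    and Xs :: "nat \<Rightarrow> 'w \<Rightarrow> real^'d"
    and \<mu> :: "(real^'d) measure"
    and \<omega> :: "real^'d \<Rightarrow> real"
    and k N :: "nat \<Rightarrow> nat"
    and p dinf J :: nat
    and ev :: "nat \<Rightarrow> real"
    and Vhat :: "nat \<Rightarrow> 'w \<Rightarrow> (real^'d) set"
  assumes "prob_space M"
    and "X \<in> borel_measurable M"
    and "prob_space.indep_vars M (\<lambda>_. borel) Xs {1..}"
    and "\<forall>i\<ge>1. distr M borel (Xs i) = distr M borel X"
    and "regularly_varying M X \<mu>"
    and "continuous_on UNIV (cdf (distr M borel (\<lambda>w. norm (X w))))"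
    and "\<omega> \<in> borel_measurable borel"
    and "\<forall>x. 0 < \<omega> x"
    and "bounded (range (rescaled \<omega>))"
    and "weakly_converges
           (\<lambda>t. distr (cond_exceed M X t) borel (\<lambda>w. rescaled \<omega> (X w)))
           (distr (limit_model \<mu>) borel (rescaled \<omega>)) at_top"
    and "\<forall>n\<ge>2. k n \<in> {1..n-1}"
    and "filterlim k at_top sequentially"
    and "(\<lambda>n. real (k n) / real n) \<longlonglongrightarrow> 0"
    and "p \<in> {1..CARD('d)-1}"
    and "N 0 = 0" and "N dinf = CARD('d)" and "\<forall>j<dinf. N j < N (Suc j)"
    and "\<forall>j\<in>{1..<dinf}. ev (Suc j) < ev j"
    and "\<forall>j\<in>{1..dinf}. \<forall>m\<in>{N (j-1)<..N j}. eigval (Sigma_lim \<mu> \<omega>) m = ereal (ev j)"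
    and "J \<in> {1..dinf}" and "N (J-1) < p" and "p \<le> N J"
    and "\<exists>\<epsilon>>0. \<forall>s\<in>{1-\<epsilon>..1+\<epsilon>}.
           (\<lambda>n. onorm ((*v) (Sigma_cond M X \<omega> (s * threshold M X n (k n)) - Sigma_nk M X \<omega> n (k n))))
             \<in> o(\<lambda>n. real (k n) powr (-1/2))"
    and "\<forall>n\<ge>2. \<forall>w\<in>space M.
           is_arg_max (emp_risk Xs \<omega> n (k n) w) (\<lambda>V. V \<in> subspaces_of_dim p) (Vhat n w)"
  shows
    "let Z = (\<lambda>n w. excess_risk (Sigma_nk M X \<omega> n (k n)) p (Vhat n w));
         a = (\<lambda>n. gap_rate (Sigma_nk M X \<omega> n (k n)) (k n) p);
         b = (\<lambda>n. ereal (1 / real (k n)) +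
               min (ereal (real (k n) powr (-1/2)))
                   (eigval (Sigma_nk M X \<omega> n (k n)) (N (J-1) + 1) - eigval (Sigma_nk M X \<omega> n (k n)) (N J)))
     in bigO_prob M Z a \<and> bigO_prob M Z b \<and> (\<forall>W. bigO_prob M W a \<longrightarrow> bigO_prob M W b)"
proof -
  interpret prob_space M by fact
  obtain B where B: "\<And>x. norm (rescaled \<omega> x) \<le> B" using assms(9) by (auto simp: bounded_iff)
  interpret exceedance_sample M X Xs \<omega> B
    by unfold_locales (use assms B in \<open>auto simp: regularly_varying_def\<close>)
  obtain v m where \<Sigma>: "eigenframe (Sigma_lim \<mu> \<omega>) v m"
    using symmetric_eigenframe[OF transpose_Sigma_lim[OF assms(5)]] .
  have lim: "(\<lambda>n. Sigma_nk M X \<omega> n (k n)) \<longlonglongrightarrow> Sigma_lim \<mu> \<omega>"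
    unfolding Sigma_nk_def
    by (rule filterlim_compose[OF Sigma_cond_tendsto[OF assms(5,10)] threshold_at_top[OF assms(11,13)]])
  have N_mono: "N i \<le> N j" if "i \<le> j" "j \<le> dinf" for i j
    using that
  proof (induction rule: dec_induct)
    case (step j)
    then have "N j < N (Suc j)" using assms(17) by simp
    then show ?case using step by simp
  qed simp
  have NJ: "N J \<le> CARD('d)" using N_mono[of J dinf] assms(16,20) by simp
  \<comment> \<open>\<open>eigval\<close> agrees with every eigenframe, so the frame values are
    constant on the limiting blocks.\<close>
  have m: "m i = ev j" if "j \<in> {1..dinf}" "i \<in> {N (j-1)<..N j}" for i j
  proof -
    have "i \<in> {1..CARD('d)}" using that N_mono[of j dinf] assms(16) by auto
    from eigval_eigenframe[OF \<Sigma> this] show ?thesis using assms(19) that by simp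
  qed
  have mp: "m p = ev J" by (rule m) (use assms in auto)
  have g0: "m p < m (N (J - 1))" if "1 \<le> N (J - 1)"
  proof -
    \<comment> \<open>A positive lower end excludes the first block, because \<open>N 0 = 0\<close>;
      hence there is a preceding block, whose last index is \<open>N (J - 1)\<close>.\<close>
    have J: "1 \<le> J - 1" using that assms(15) by (cases "J - 1") auto
    then have *: "Suc (J - 1 - 1) = J - 1" "Suc (J - 1) = J" "J - 1 < dinf" using assms(20) by auto
    then have "N (J - 1 - 1) < N (J - 1)" using assms(17) by (metis Suc_lessD)
    then have "m (N (J - 1)) = ev (J - 1)" using J * by (intro m) auto
    moreover have "J - 1 \<in> {1..<dinf}" using J * by auto
    then have "ev J < ev (J - 1)" using assms(18) * by metis
    ultimately show ?thesis using mp by simp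
  qed
  have g1: "m (N J + 1) < m p" if "N J < CARD('d)"
  proof -
    \<comment> \<open>The final block ends at the dimension, so here another block follows, and
      \<open>N J + 1\<close> is its first index.\<close>
    have J: "J < dinf" using that assms(16,20) by (cases "J = dinf") auto
    then have "N J < N (Suc J)" using assms(17) by simp
    then have "m (N J + 1) = ev (Suc J)" using J by (intro m) auto
    then show ?thesis using mp assms(18,20) J by auto
  qed
  obtain C where C: "0 < C" "\<forall>\<^sub>F n in sequentially. gap_rate (Sigma_nk M X \<omega> n (k n)) (k n) p \<le>
    ereal C * (ereal (1 / real (k n)) + min (ereal (real (k n) powr (-1/2)))
      (eigval (Sigma_nk M X \<omega> n (k n)) (N (J-1) + 1) - eigval (Sigma_nk M X \<omega> n (k n)) (N J)))"
    using gap_rate_eventually_le[OF assms(14,11) lim \<Sigma> assms(21,22) NJ g0 g1] .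
  \<comment> \<open>The first conjunct is the gap rate bound; the comparison of rates gives the
    other two.\<close>
  show ?thesis
    unfolding Let_def
    using excess_risk_bigO_gap_rate[OF assms(14,11,24)] bigO_prob_mono[OF _ C] by blast
qed

end
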